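(* Let $\Bbbk$ be a field. If $G$ is a bipartite graph with maximum degree $\Delta(G)\le 3$ and at least $3$ vertices that is prime over $\Bbbk$, then $G$ is $2$-connected.
   Context: $\operatorname{reg}_{\Bbbk}(G)=\max\{j\ge0:\widetilde H_{j-1}(\operatorname{Ind}(G[S]);\Bbbk)\neq0\text{ for some }S\subseteq V(G)\}$, $\operatorname{Ind}$ the independence complex. A connected graph $G$ is prime over $\Bbbk$ if $\operatorname{reg}_{\Bbbk}(G-x)<\operatorname{reg}_{\Bbbk}(G)$ for every vertex $x$. *)

theory Defs
  imports Main
begin

definition simple_graph :: "'a set \<Rightarrow> 'a set set \<Rightarrow> bool" where
  "simple_graph V E \<longleftrightarrow> finite V \<and>
     (\<forall>e\<in>E. \<exists>u v. e = {u, v} \<and> u \<noteq> v \<and> u \<in> V \<and> v \<in> V)"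

definition connected_graph :: "'a set \<Rightarrow> 'a set set \<Rightarrow> bool" where
  "connected_graph V E \<longleftrightarrow> V \<noteq> {} \<and>
     (\<forall>u\<in>V. \<forall>v\<in>V. (\<lambda>a b. {a, b} \<in> E)\<^sup>*\<^sup>* u v)"

definition del_vertex_V :: "'a set \<Rightarrow> 'a \<Rightarrow> 'a set" where
  "del_vertex_V V x = V - {x}"

definition del_vertex_E :: "'a set set \<Rightarrow> 'a \<Rightarrow> 'a set set" where
  "del_vertex_E E x = {e \<in> E. x \<notin> e}"

definition two_connected :: "'a set \<Rightarrow> 'a set set \<Rightarrow> bool" where
  "two_connected V E \<longleftrightarrow> card V \<ge> 3 \<and> connected_graph V E \<and>
     (\<forall>x\<in>V. connected_graph (del_vertex_V V x) (del_vertex_E E x))"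

definition bipartite :: "'a set \<Rightarrow> 'a set set \<Rightarrow> bool" where
  "bipartite V E \<longleftrightarrow> (\<exists>A \<subseteq> V. \<forall>u v. {u, v} \<in> E \<longrightarrow> (u \<in> A \<longleftrightarrow> v \<notin> A))"

definition degree :: "'a set set \<Rightarrow> 'a \<Rightarrow> nat" where
  "degree E v = card {u. {u, v} \<in> E}"

definition max_degree_le :: "'a set \<Rightarrow> 'a set set \<Rightarrow> nat \<Rightarrow> bool" where
  "max_degree_le V E d \<longleftrightarrow> (\<forall>v\<in>V. degree E v \<le> d)"

definition Ind :: "'a set set \<Rightarrow> 'a set \<Rightarrow> 'a set set" where
  "Ind E S = {F. F \<subseteq> S \<and> (\<forall>u\<in>F. \<forall>v\<in>F. {u, v} \<notin> E)}"

text \<open>Oriented simplicial chains: a chain is a function from faces to the field;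
  simplices are oriented by the linear order on vertices.
  The coefficient of the face tau in the boundary of tau+{v} is
  (-1)^(number of vertices of tau below v).  The empty face is included in
  the complex, so the resulting chain complex is the augmented one, whose
  homology is reduced homology.\<close>

definition bd_sign :: "'a::linorder set \<Rightarrow> 'a \<Rightarrow> 'k::field" where
  "bd_sign \<tau> v = (-1) ^ card {u \<in> \<tau>. u < v}"

definition boundary :: "'a::linorder set set \<Rightarrow> ('a set \<Rightarrow> 'k::field) \<Rightarrow> 'a set \<Rightarrow> 'k" where
  "boundary \<Delta> c \<tau> =
     (\<Sum>v \<in> {v \<in> \<Union>\<Delta> - \<tau>. insert v \<tau> \<in> \<Delta>}. bd_sign \<tau> v * c (insert v \<tau>))"

text \<open>n-chains of Delta: supported on faces with n vertices (dimension n-1).\<close>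
definition chains :: "'a set set \<Rightarrow> nat \<Rightarrow> ('a set \<Rightarrow> 'k::field) set" where
  "chains \<Delta> n = {c. \<forall>\<sigma>. c \<sigma> \<noteq> 0 \<longrightarrow> \<sigma> \<in> \<Delta> \<and> card \<sigma> = n}"

text \<open>The reduced homology group H~_{n-1}(Delta; k) is nonzero iff there is a
  cycle on faces with n vertices which is not a boundary.\<close>
definition red_homology_nonzero ::
    "'k::field itself \<Rightarrow> 'a::linorder set set \<Rightarrow> nat \<Rightarrow> bool" where
  "red_homology_nonzero _ \<Delta> n \<longleftrightarrow>
     (\<exists>c :: 'a set \<Rightarrow> 'k. c \<in> chains \<Delta> n \<and>
        (\<forall>\<tau>. boundary \<Delta> c \<tau> = 0) \<and>
        \<not> (\<exists>b \<in> chains \<Delta> (Suc n). \<forall>\<sigma>. c \<sigma> = boundary \<Delta> b \<sigma>))"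

definition reg :: "'k::field itself \<Rightarrow> 'a::linorder set \<Rightarrow> 'a set set \<Rightarrow> nat" where
  "reg K V E = Max {j. \<exists>S \<subseteq> V. red_homology_nonzero K (Ind E S) j}"

definition prime_graph :: "'k::field itself \<Rightarrow> 'a::linorder set \<Rightarrow> 'a set set \<Rightarrow> bool" where
  "prime_graph K V E \<longleftrightarrow> connected_graph V E \<and>
     (\<forall>x\<in>V. reg K (del_vertex_V V x) (del_vertex_E E x) < reg K V E)"

end

theory Submission
  imports Defs "HOL.Vector_Spaces" "HOL-Library.Function_Algebras"
begin

text \<open>Primality of a graph says that the top homology of degree \<open>r\<close> occurs on \<open>V\<close> and on
  no proper subset.  A cut vertex of degree at most three lies on a bridge \<open>xy\<close>, with \<open>A \<ni> x\<close> and
  \<open>B \<ni> y\<close> its two sides.  Deleting \<open>y\<close>, respectively \<open>x\<close>, and applying the Kuenneth formula gives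
  homology of degree \<open>i\<close> on \<open>A - x\<close> and \<open>j\<close> on \<open>B - N[y]\<close>, and of degree \<open>i'\<close> on \<open>A - N[x]\<close> and
  \<open>j'\<close> on \<open>B - y\<close>, where \<open>i + j = i' + j' = r - 1\<close>.  Recombining the factors, \<open>(A - x) \<union> (B - y)\<close>
  carries degree \<open>i + j'\<close>, and \<open>(A - N[x]) \<union> (B - N[y])\<close> together with the now isolated edge
  \<open>xy\<close> carries degree \<open>i' + j + 1\<close>.  These sum to \<open>2r - 1\<close>, so one of them is at least \<open>r\<close>,
  on a proper subset of \<open>V\<close>.\<close>

section \<open>Chains and homology of finite complexes\<close>

text \<open>On chains of a complex with vertices in \<open>W\<close>, summing over all of \<open>W\<close> gives the
  same boundary, but the operator no longer depends on the complex.\<close>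

definition bd :: "'a::linorder set \<Rightarrow> ('a set \<Rightarrow> 'k::field) \<Rightarrow> 'a set \<Rightarrow> 'k" where
  "bd W c \<tau> = (\<Sum>v \<in> W - \<tau>. bd_sign \<tau> v * c (insert v \<tau>))"

text \<open>The ungraded space of chains: all degrees together, which is where linear algebra is
  applied before degrees are separated.\<close>

definition supported :: "'a set set \<Rightarrow> ('a set \<Rightarrow> 'k::field) set" where
  "supported \<Delta> = {c. \<forall>\<sigma>. c \<sigma> \<noteq> 0 \<longrightarrow> \<sigma> \<in> \<Delta>}"

text \<open>\<open>W\<close> may contain points that are not vertices, so the deletion and the link
  of a vertex are again complexes on the same \<open>W\<close> and share the operator
  \<open>bd W\<close>.\<close>

definition complex_on :: "'a set \<Rightarrow> 'a set set \<Rightarrow> bool" where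
  "complex_on W \<Delta> \<longleftrightarrow> finite W \<and> \<Delta> \<subseteq> Pow W \<and> (\<forall>\<sigma>\<in>\<Delta>. \<forall>\<tau>\<subseteq>\<sigma>. \<tau> \<in> \<Delta>)"

lemma complex_onD:
  assumes "complex_on W \<Delta>"
  shows "finite W" "\<sigma> \<in> \<Delta> \<Longrightarrow> \<sigma> \<subseteq> W" "\<sigma> \<in> \<Delta> \<Longrightarrow> finite \<sigma>"
    "\<sigma> \<in> \<Delta> \<Longrightarrow> \<tau> \<subseteq> \<sigma> \<Longrightarrow> \<tau> \<in> \<Delta>"
  using assms unfolding complex_on_def by (auto intro: finite_subset)

lemma chainsD:
  assumes "c \<in> chains \<Delta> n"
  shows "c \<sigma> \<noteq> 0 \<Longrightarrow> \<sigma> \<in> \<Delta>" "c \<sigma> \<noteq> 0 \<Longrightarrow> card \<sigma> = n"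
    "\<sigma> \<notin> \<Delta> \<Longrightarrow> c \<sigma> = 0" "card \<sigma> \<noteq> n \<Longrightarrow> c \<sigma> = 0"
  using assms unfolding chains_def by auto

lemma chains_supported: "c \<in> chains \<Delta> n \<Longrightarrow> c \<in> supported \<Delta>"
  by (auto simp: chains_def supported_def)

lemma chains_minus:
  "c \<in> chains \<Delta> n \<Longrightarrow> d \<in> chains \<Delta> n \<Longrightarrow> (\<lambda>\<sigma>. c \<sigma> - d \<sigma>) \<in> chains \<Delta> n"
  by (force simp: chains_def)

lemma chains_add:
  "c \<in> chains \<Delta> n \<Longrightarrow> d \<in> chains \<Delta> n \<Longrightarrow> (\<lambda>\<sigma>. c \<sigma> + d \<sigma>) \<in> chains \<Delta> n"
  by (force simp: chains_def)

lemma bd_add: "bd W (\<lambda>\<sigma>. c \<sigma> + d \<sigma>) = (\<lambda>\<sigma>. bd W c \<sigma> + bd W d \<sigma>)"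
  by (simp add: bd_def fun_eq_iff algebra_simps sum.distrib)

lemma bd_diff: "bd W (\<lambda>\<sigma>. c \<sigma> - d \<sigma>) = (\<lambda>\<sigma>. bd W c \<sigma> - bd W d \<sigma>)"
  by (simp add: bd_def fun_eq_iff algebra_simps sum_subtractf)

lemma bd_scale: "bd W (\<lambda>\<sigma>. a * c \<sigma>) = (\<lambda>\<sigma>. a * bd W c \<sigma>)"
  by (simp add: bd_def fun_eq_iff algebra_simps sum_distrib_left)


text \<open>The additional summands of \<open>bd W\<close> belong to sets outside
  \<open>\<Delta>\<close>, where \<open>c\<close> vanishes.\<close>

lemma boundary_eq_bd:
  assumes "complex_on W \<Delta>" "c \<in> supported \<Delta>"
  shows "boundary \<Delta> c = bd W c"
proof
  fix \<tau>
  show "boundary \<Delta> c \<tau> = bd W c \<tau>"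
    unfolding boundary_def bd_def
    by (rule sum.mono_neutral_left)
      (use assms in \<open>auto simp: complex_on_def supported_def\<close>)
qed

lemma red_homology_nonzero_iff:
  fixes \<Delta> :: "'a::linorder set set"
  assumes "complex_on W \<Delta>"
  shows "red_homology_nonzero TYPE('k::field) \<Delta> n \<longleftrightarrow>
    (\<exists>c :: 'a set \<Rightarrow> 'k. c \<in> chains \<Delta> n \<and> bd W c = (\<lambda>_. 0) \<and>
      (\<forall>b \<in> chains \<Delta> (Suc n). c \<noteq> bd W b))"
  unfolding red_homology_nonzero_def
  by (auto simp: boundary_eq_bd[OF assms chains_supported] fun_eq_iff)

lemma not_red_homology_nonzeroD:
  fixes c :: "'a::linorder set \<Rightarrow> 'k::field"
  assumes "\<not> red_homology_nonzero TYPE('k) \<Delta> n" "complex_on W \<Delta>"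
    "c \<in> chains \<Delta> n" "bd W c = (\<lambda>_. 0)"
  obtains b where "b \<in> chains \<Delta> (Suc n)" "c = bd W b"
  using assms red_homology_nonzero_iff by blast

lemma bd_nonzeroE:
  assumes "bd W c \<tau> \<noteq> 0"
  obtains v where "v \<in> W - \<tau>" "c (insert v \<tau>) \<noteq> 0"
proof -
  have "\<exists>v\<in>W - \<tau>. bd_sign \<tau> v * c (insert v \<tau>) \<noteq> 0"
    using assms unfolding bd_def by (meson sum.neutral)
  then show ?thesis using that by auto
qed

lemma bd_supported:
  assumes "complex_on W \<Delta>" "c \<in> supported \<Delta>"
  shows "bd W c \<in> supported \<Delta>"
proof -
  have "\<tau> \<in> \<Delta>" if nz: "bd W c \<tau> \<noteq> 0" for \<tau>
  proof -
    obtain v where "c (insert v \<tau>) \<noteq> 0"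
      using bd_nonzeroE[OF nz] by blast
    then show ?thesis
      using assms complex_onD(4)[OF assms(1)] unfolding supported_def by blast
  qed
  then show ?thesis by (auto simp: supported_def)
qed

lemma bd_chains:
  assumes "complex_on W \<Delta>" "c \<in> chains \<Delta> (Suc n)"
  shows "bd W c \<in> chains \<Delta> n"
proof -
  have "\<tau> \<in> \<Delta> \<and> card \<tau> = n" if nz: "bd W c \<tau> \<noteq> 0" for \<tau>
  proof -
    obtain v where v: "v \<in> W - \<tau>" "c (insert v \<tau>) \<noteq> 0"
      using bd_nonzeroE[OF nz] by blast
    have "insert v \<tau> \<in> \<Delta>" "card (insert v \<tau>) = Suc n" using chainsD(1,2)[OF assms(2)] v by blast+
    then show ?thesis
      using v complex_onD(3,4)[OF assms(1)] by (metis DiffD2 card_insert_disjoint diff_Suc_1 finite_insert subset_insertI)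
  qed
  then show ?thesis by (auto simp: chains_def)
qed

section \<open>Orientation signs and the square of the boundary\<close>

lemma bd_sign_square: "bd_sign \<tau> v * bd_sign \<tau> v = (1 :: 'k::field)"
  by (simp add: bd_sign_def flip: power_add)

lemma bd_sign_insert:
  assumes "finite \<tau>" "w \<notin> \<tau>"
  shows "bd_sign (insert w \<tau>) v = ((if w < v then -1 else 1) * bd_sign \<tau> v :: 'k::field)"
proof -
  have "{u \<in> insert w \<tau>. u < v} = (if w < v then insert w {u \<in> \<tau>. u < v} else {u \<in> \<tau>. u < v})"
    by auto
  then show ?thesis using assms by (simp add: bd_sign_def)
qed

text \<open>Exactly one of \<open>w < v\<close> and \<open>v < w\<close> holds, so exactly one of
  the two insertions changes a sign.\<close>

lemma bd_sign_swap:
  assumes "finite \<tau>" "w \<notin> \<tau>" "v \<notin> \<tau>" "v \<noteq> w"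
  shows "bd_sign (insert w \<tau>) v * bd_sign (insert v \<tau>) w =
    (- (bd_sign \<tau> v * bd_sign \<tau> w) :: 'k::field)"
  using assms by (auto simp: bd_sign_insert)

lemma bd_sign_anticommute:
  assumes "finite \<tau>" "w \<notin> \<tau>" "v \<notin> \<tau>" "v \<noteq> w"
  shows "bd_sign \<tau> v * bd_sign (insert v \<tau>) w =
    (- (bd_sign \<tau> w * bd_sign (insert w \<tau>) v) :: 'k::field)"
  using assms by (auto simp: bd_sign_insert)

text \<open>The pairs are split by the order of their entries, and the two halves cancel. Comparing
  the sum with its own negative would only show that twice the sum is zero, which is too weak in
  characteristic 2.\<close>

lemma sum_antisymmetric:
  fixes f :: "'a::linorder \<Rightarrow> 'a \<Rightarrow> 'k::ab_group_add"
  assumes "finite A" "\<And>v w. v \<in> A \<Longrightarrow> w \<in> A \<Longrightarrow> v \<noteq> w \<Longrightarrow> f v w = - f w v"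
  shows "(\<Sum>v\<in>A. \<Sum>w\<in>A - {v}. f v w) = 0"
proof -
  let ?g = "\<lambda>v w. if v < w then f v w else 0"
  let ?h = "\<lambda>v w. if w < v then f v w else 0"
  have "(\<Sum>w\<in>A - {v}. f v w) = (\<Sum>w\<in>A. ?g v w + ?h v w)" for v
    by (rule sum.mono_neutral_cong_left) (use assms(1) in auto)
  then have "(\<Sum>v\<in>A. \<Sum>w\<in>A - {v}. f v w) = (\<Sum>v\<in>A. \<Sum>w\<in>A. ?g v w) + (\<Sum>v\<in>A. \<Sum>w\<in>A. ?h v w)"
    by (simp add: sum.distrib)
  also have "(\<Sum>v\<in>A. \<Sum>w\<in>A. ?h v w) = (\<Sum>w\<in>A. \<Sum>v\<in>A. ?h v w)" by (rule sum.swap)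
  also have "\<dots> = (\<Sum>w\<in>A. \<Sum>v\<in>A. - ?g w v)"
  proof (intro sum.cong refl)
    show "?h v w = - ?g w v" if "w \<in> A" "v \<in> A" for v w
      using assms(2)[of v w] that by (cases "w < v") auto
  qed
  finally show ?thesis by (simp add: sum_negf)
qed

text \<open>Inserting \<open>v\<close> then \<open>w\<close> and inserting \<open>w\<close> then
  \<open>v\<close> reach the same face with opposite signs.\<close>

lemma bd_bd:
  fixes c :: "'a::linorder set \<Rightarrow> 'k::field"
  assumes "complex_on W \<Delta>" "c \<in> supported \<Delta>"
  shows "bd W (bd W c) = (\<lambda>_. 0)"
proof
  fix \<tau>
  show "bd W (bd W c) \<tau> = 0"
  proof (cases "finite \<tau>")
    case True
    have "bd W (bd W c) \<tau> = (\<Sum>v\<in>W - \<tau>. \<Sum>w\<in>(W - \<tau>) - {v}.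
        bd_sign \<tau> v * bd_sign (insert v \<tau>) w * c (insert w (insert v \<tau>)))"
      unfolding bd_def
      by (intro sum.cong refl, subst sum_distrib_left) (auto intro!: sum.cong simp: mult.assoc)
    also have "\<dots> = 0"
    proof (rule sum_antisymmetric)
      fix v w assume "v \<in> W - \<tau>" "w \<in> W - \<tau>" "v \<noteq> w"
      then have "bd_sign \<tau> v * bd_sign (insert v \<tau>) w = (- (bd_sign \<tau> w * bd_sign (insert w \<tau>) v) :: 'k)"
        using True by (intro bd_sign_anticommute) auto
      then show "bd_sign \<tau> v * bd_sign (insert v \<tau>) w * c (insert w (insert v \<tau>)) =
          - (bd_sign \<tau> w * bd_sign (insert w \<tau>) v * c (insert v (insert w \<tau>)))"
        by (simp add: insert_commute)
    qed (use complex_onD(1)[OF assms(1)] in auto)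
    finally show ?thesis .
  next
    \<comment> \<open>Infinite sets have \<open>card\<close> zero and escape the sign identities,
      but there all summands vanish.\<close>
    case False
    then have "c (insert w (insert v \<tau>)) = 0" for v w
      using assms(2) complex_onD(3)[OF assms(1), of "insert w (insert v \<tau>)"]
      by (auto simp: supported_def)
    then show ?thesis by (simp add: bd_def)
  qed
qed

section \<open>Deletion and link of a vertex\<close>

text \<open>This is exactness in the middle of the sequence from the homology of the deletion to
  that of \<open>\<Delta>\<close> to that of the link, the last in one degree less. If the link part
  of a cycle bounds, coning the bounding chain with apex \<open>y\<close> moves the cycle into the
  deletion, where it bounds as well.\<close>

lemma deletion_or_link_homology:
  fixes \<Delta> :: "'a::linorder set set"
  assumes \<Delta>: "complex_on W \<Delta>" and h: "red_homology_nonzero TYPE('k::field) \<Delta> (Suc n)"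
  shows "red_homology_nonzero TYPE('k) {\<sigma> \<in> \<Delta>. y \<notin> \<sigma>} (Suc n) \<or>
    red_homology_nonzero TYPE('k) {\<sigma>. y \<notin> \<sigma> \<and> insert y \<sigma> \<in> \<Delta>} n"
proof (rule ccontr)
  let ?D = "{\<sigma> \<in> \<Delta>. y \<notin> \<sigma>}" and ?L = "{\<sigma>. y \<notin> \<sigma> \<and> insert y \<sigma> \<in> \<Delta>}"
  assume neg: "\<not> ?thesis"
  note D = complex_onD[OF \<Delta>]
  have cD: "complex_on W ?D" using \<Delta> unfolding complex_on_def by blast
  have cL: "complex_on W ?L"
    unfolding complex_on_def
  proof (intro conjI ballI allI impI)
    show "\<tau> \<in> ?L" if "\<sigma> \<in> ?L" "\<tau> \<subseteq> \<sigma>" for \<sigma> \<tau>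
      using that D(4)[of "insert y \<sigma>" "insert y \<tau>"] by blast
  qed (use D in auto)
  obtain c :: "'a set \<Rightarrow> 'k" where c: "c \<in> chains \<Delta> (Suc n)" "bd W c = (\<lambda>_. 0)"
      "\<And>b. b \<in> chains \<Delta> (Suc (Suc n)) \<Longrightarrow> c \<noteq> bd W b"
    using h red_homology_nonzero_iff[OF \<Delta>] by blast
  \<comment> \<open>The part of \<open>c\<close> on faces containing \<open>y\<close>, with
    \<open>y\<close> removed; the sign makes it a cycle of the link.\<close>
  define e where "e \<sigma> = (if y \<in> \<sigma> then 0 else bd_sign \<sigma> y * c (insert y \<sigma>))" for \<sigma>
  have e_ch: "e \<in> chains ?L n"
    unfolding chains_def
  proof (intro CollectI allI impI)
    fix \<sigma> assume "e \<sigma> \<noteq> 0"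
    then have *: "y \<notin> \<sigma>" "c (insert y \<sigma>) \<noteq> 0" unfolding e_def by (auto split: if_splits)
    then have "insert y \<sigma> \<in> \<Delta>" "card (insert y \<sigma>) = Suc n" using chainsD(1,2)[OF c(1)] by blast+
    moreover have "finite \<sigma>" using D(3)[OF calculation(1)] by simp
    ultimately show "\<sigma> \<in> ?L \<and> card \<sigma> = n" using * by auto
  qed
  have e_cyc: "bd W e = (\<lambda>_. 0)"
  proof
    fix \<sigma>
    show "bd W e \<sigma> = 0"
    proof (cases "y \<in> \<sigma> \<or> infinite \<sigma>")
      case True
      then have "e (insert v \<sigma>) = 0" for v
        using chainsD(3)[OF e_ch] complex_onD(3)[OF cL] e_def by (metis finite_insert insertI2)
      then show ?thesis by (simp add: bd_def)
    next
      case False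
      have "bd W e \<sigma> = (\<Sum>v\<in>W - insert y \<sigma>. bd_sign \<sigma> v * e (insert v \<sigma>))"
        unfolding bd_def by (rule sum.mono_neutral_right) (use D(1) in \<open>auto simp: e_def\<close>)
      also have "\<dots> = (\<Sum>v\<in>W - insert y \<sigma>. - bd_sign \<sigma> y *
          (bd_sign (insert y \<sigma>) v * c (insert v (insert y \<sigma>))))"
        using False bd_sign_anticommute[of \<sigma> y, where 'k = 'k]
        by (intro sum.cong refl) (auto simp: e_def insert_commute simp flip: mult.assoc)
      also have "\<dots> = - bd_sign \<sigma> y * bd W c (insert y \<sigma>)"
        unfolding bd_def by (rule sum_distrib_left[symmetric])
      finally show ?thesis using c(2) by simp
    qed
  qed
  obtain f where f: "f \<in> chains ?L (Suc n)" "e = bd W f"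
    using not_red_homology_nonzeroD[OF _ cL e_ch e_cyc] neg by blast
  \<comment> \<open>The cone with apex \<open>y\<close> over \<open>f\<close>. The minus sign
    compensates for \<open>bd_sign_swap\<close>, so that \<open>bd W F\<close> agrees with
    \<open>c\<close> on every face containing \<open>y\<close>.\<close>
  define F where "F \<rho> = (if y \<in> \<rho> then - bd_sign (\<rho> - {y}) y * f (\<rho> - {y}) else 0)" for \<rho>
  have F_ch: "F \<in> chains \<Delta> (Suc (Suc n))"
    unfolding chains_def
  proof (intro CollectI allI impI)
    fix \<rho> assume "F \<rho> \<noteq> 0"
    then have *: "y \<in> \<rho>" "f (\<rho> - {y}) \<noteq> 0" unfolding F_def by (auto split: if_splits)
    then have "\<rho> - {y} \<in> ?L" "card (\<rho> - {y}) = Suc n" using chainsD(1,2)[OF f(1)] by blast+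
    then show "\<rho> \<in> \<Delta> \<and> card \<rho> = Suc (Suc n)"
      using * by (metis (no_types, lifting) card.insert_remove card.infinite finite_Diff_insert
        insert_Diff mem_Collect_eq nat.distinct(1) insert_Diff_single)
  qed
  have bdF: "bd W F \<rho> = c \<rho>" if "y \<in> \<rho>" for \<rho>
  proof (cases "finite \<rho>")
    case False
    then have "F (insert v \<rho>) = 0" "c \<rho> = 0" for v
      using chainsD(3)[OF F_ch] chainsD(3)[OF c(1)] D(3) by (metis finite_insert)+
    then show ?thesis by (simp add: bd_def)
  next
    case True
    define \<sigma> where "\<sigma> = \<rho> - {y}"
    have \<sigma>: "\<rho> = insert y \<sigma>" "y \<notin> \<sigma>" "finite \<sigma>" using that True by (auto simp: \<sigma>_def)
    have "bd W F \<rho> = (\<Sum>v\<in>W - insert y \<sigma>. bd_sign \<sigma> y * (bd_sign \<sigma> v * f (insert v \<sigma>)))"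
      unfolding bd_def \<sigma>(1)
    proof (intro sum.cong refl)
      fix v assume v: "v \<in> W - insert y \<sigma>"
      then have "insert v (insert y \<sigma>) - {y} = insert v \<sigma>" using \<sigma> by auto
      then have "bd_sign (insert y \<sigma>) v * F (insert v (insert y \<sigma>)) =
          - (bd_sign (insert y \<sigma>) v * bd_sign (insert v \<sigma>) y) * f (insert v \<sigma>)"
        by (simp add: F_def)
      also have "\<dots> = bd_sign \<sigma> y * (bd_sign \<sigma> v * f (insert v \<sigma>))"
        using v \<sigma> by (subst bd_sign_swap) auto
      finally show "bd_sign (insert y \<sigma>) v * F (insert v (insert y \<sigma>)) =
          bd_sign \<sigma> y * (bd_sign \<sigma> v * f (insert v \<sigma>))" .
    qed
    also have "\<dots> = bd_sign \<sigma> y * (\<Sum>v\<in>W - insert y \<sigma>. bd_sign \<sigma> v * f (insert v \<sigma>))"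
      by (rule sum_distrib_left[symmetric])
    also have "(\<Sum>v\<in>W - insert y \<sigma>. bd_sign \<sigma> v * f (insert v \<sigma>)) = bd W f \<sigma>"
      unfolding bd_def
      by (rule sum.mono_neutral_left) (use D(1) chainsD(3)[OF f(1)] in auto)
    also have "bd_sign \<sigma> y * bd W f \<sigma> = c \<rho>"
      using \<sigma> bd_sign_square[of \<sigma> y, where 'k = 'k] f(2)
      by (simp add: e_def flip: f(2) mult.assoc)
    finally show ?thesis .
  qed
  \<comment> \<open>Homologous to \<open>c\<close> and zero on all faces containing
    \<open>y\<close>.\<close>
  define c' where "c' \<sigma> = c \<sigma> - bd W F \<sigma>" for \<sigma>
  have "c' \<in> chains \<Delta> (Suc n)"
    unfolding c'_def by (intro chains_minus c bd_chains[OF \<Delta>] F_ch)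
  then have c'_ch: "c' \<in> chains ?D (Suc n)"
    using bdF unfolding chains_def by (auto simp: c'_def)
  have c'_cyc: "bd W c' = (\<lambda>_. 0)"
    unfolding c'_def bd_diff using c(2) bd_bd[OF \<Delta> chains_supported[OF F_ch]] by simp
  obtain b where b: "b \<in> chains ?D (Suc (Suc n))" "c' = bd W b"
    using not_red_homology_nonzeroD[OF _ cD c'_ch c'_cyc] neg by blast
  have "b \<in> chains \<Delta> (Suc (Suc n))" using b(1) unfolding chains_def by auto
  then have "(\<lambda>\<sigma>. F \<sigma> + b \<sigma>) \<in> chains \<Delta> (Suc (Suc n))" by (intro chains_add F_ch)
  moreover have "c = bd W (\<lambda>\<sigma>. F \<sigma> + b \<sigma>)"
    unfolding bd_add by (simp add: c'_def fun_eq_iff flip: b(2))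
  ultimately show False using c(3) by blast
qed

section \<open>Contraction onto homology\<close>

text \<open>Linearity for the pointwise operations, spelled out so that it rewrites lambda terms
  directly; \<open>bd_section\<close> connects it with \<open>Vector_Spaces.linear\<close>.\<close>

definition lin :: "(('b \<Rightarrow> 'k::field) \<Rightarrow> 'b \<Rightarrow> 'k) \<Rightarrow> bool" where
  "lin f \<longleftrightarrow> (\<forall>c d. f (\<lambda>\<sigma>. c \<sigma> + d \<sigma>) = (\<lambda>\<sigma>. f c \<sigma> + f d \<sigma>)) \<and>
    (\<forall>a c. f (\<lambda>\<sigma>. a * c \<sigma>) = (\<lambda>\<sigma>. a * f c \<sigma>))"

lemma linD:
  assumes "lin f"
  shows "f (\<lambda>\<sigma>. c \<sigma> + d \<sigma>) = (\<lambda>\<sigma>. f c \<sigma> + f d \<sigma>)"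
    "f (\<lambda>\<sigma>. a * c \<sigma>) = (\<lambda>\<sigma>. a * f c \<sigma>)" "f (\<lambda>\<sigma>. 0) = (\<lambda>\<sigma>. 0)"
    "f (\<lambda>\<sigma>. c \<sigma> - d \<sigma>) = (\<lambda>\<sigma>. f c \<sigma> - f d \<sigma>)"
proof -
  have add: "f (\<lambda>\<sigma>. c \<sigma> + d \<sigma>) = (\<lambda>\<sigma>. f c \<sigma> + f d \<sigma>)"
    and scale: "f (\<lambda>\<sigma>. a * c \<sigma>) = (\<lambda>\<sigma>. a * f c \<sigma>)" for a c d
    using assms unfolding lin_def by blast+
  show "f (\<lambda>\<sigma>. c \<sigma> + d \<sigma>) = (\<lambda>\<sigma>. f c \<sigma> + f d \<sigma>)" "f (\<lambda>\<sigma>. a * c \<sigma>) = (\<lambda>\<sigma>. a * f c \<sigma>)"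
    by (fact add scale)+
  show "f (\<lambda>\<sigma>. 0) = (\<lambda>\<sigma>. 0)" using scale[of 0] by simp
  show "f (\<lambda>\<sigma>. c \<sigma> - d \<sigma>) = (\<lambda>\<sigma>. f c \<sigma> - f d \<sigma>)"
    using add[of c "\<lambda>\<sigma>. - 1 * d \<sigma>"] scale[of "- 1" d] by simp
qed

lemma lin_sum:
  assumes "lin f"
  shows "f (\<lambda>\<sigma>. \<Sum>i\<in>I. a i * c i \<sigma>) = (\<lambda>\<sigma>. \<Sum>i\<in>I. a i * f (c i) \<sigma>)"
  by (induction I rule: infinite_finite_induct) (auto simp: linD[OF assms])

lemma bd_lin: "lin (bd W :: ('a::linorder set \<Rightarrow> 'k::field) \<Rightarrow> _)"
  by (simp add: lin_def bd_add bd_scale)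

text \<open>Over a field, a linear map restricted to a subspace has a linear right inverse on its
  image; the subspace is \<open>supported \<Delta>\<close>.\<close>

lemma bd_section:
  "\<exists>g. lin g \<and> (\<forall>c. g c \<in> supported \<Delta>) \<and>
    (\<forall>b \<in> supported \<Delta>. bd W (g (bd W b)) = (bd W b :: 'a::linorder set \<Rightarrow> 'k::field))"
proof -
  define s :: "'k \<Rightarrow> ('a set \<Rightarrow> 'k) \<Rightarrow> 'a set \<Rightarrow> 'k" where "s a c = (\<lambda>\<sigma>. a * c \<sigma>)" for a c
  interpret vector_space s
    by unfold_locales (auto simp: s_def fun_eq_iff algebra_simps)
  interpret pair: vector_space_pair s s ..
  have "Vector_Spaces.linear s s (bd W)"
    by unfold_locales (auto simp: s_def plus_fun_def bd_add bd_scale)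
  moreover have "subspace (supported \<Delta>)"
    unfolding subspace_def supported_def by (force simp: s_def)
  ultimately obtain g where g: "range g \<subseteq> supported \<Delta>" "Vector_Spaces.linear s s g"
      "\<And>v. v \<in> bd W ` supported \<Delta> \<Longrightarrow> bd W (g v) = v"
    using pair.linear_exists_right_inverse_on[of "bd W" "supported \<Delta>"] by auto
  interpret Vector_Spaces.linear s s g by (fact g(2))
  have "lin g" using add scale unfolding lin_def s_def plus_fun_def by blast
  then show ?thesis using g by blast
qed

text \<open>Every boundary operator over a field has a generalised inverse; keeping only its
  components that raise the number of vertices by one makes it graded.\<close>

lemma bd_graded_section:
  assumes \<Delta>: "complex_on W \<Delta>"
  obtains g :: "('a::linorder set \<Rightarrow> 'k::field) \<Rightarrow> 'a set \<Rightarrow> 'k"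
  where "lin g" "\<And>c. g c \<in> supported \<Delta>"
    "\<And>n c. c \<in> chains \<Delta> n \<Longrightarrow> g c \<in> chains \<Delta> (Suc n)"
    "\<And>b. b \<in> supported \<Delta> \<Longrightarrow> bd W (g (bd W b)) = bd W b"
proof -
  obtain g0 :: "('a set \<Rightarrow> 'k) \<Rightarrow> 'a set \<Rightarrow> 'k"
    where g0: "lin g0" "\<And>c. g0 c \<in> supported \<Delta>"
      "\<And>b. b \<in> supported \<Delta> \<Longrightarrow> bd W (g0 (bd W b)) = bd W b"
    using bd_section by blast
  define pr where "pr m c \<sigma> = (if card \<sigma> = m then c \<sigma> else 0)" for m and c :: "'a set \<Rightarrow> 'k" and \<sigma>
  \<comment> \<open>On faces with \<open>m + 1\<close> vertices only the \<open>m\<close>-vertex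
    part of the argument is used. The value 0 at cardinality 0 avoids the truncated
    predecessor.\<close>
  define g where "g c \<sigma> = (if card \<sigma> = 0 then 0 else g0 (pr (card \<sigma> - 1) c) \<sigma>)" for c \<sigma>
  have pr: "pr m (\<lambda>\<sigma>. c \<sigma> + d \<sigma>) = (\<lambda>\<sigma>. pr m c \<sigma> + pr m d \<sigma>)"
    "pr m (\<lambda>\<sigma>. a * c \<sigma>) = (\<lambda>\<sigma>. a * pr m c \<sigma>)" for m c d a
    by (auto simp: pr_def fun_eq_iff)
  have "lin g" unfolding lin_def by (auto simp: g_def fun_eq_iff pr linD[OF g0(1)])
  moreover have "g c \<in> supported \<Delta>" for c
    using g0(2) unfolding supported_def by (auto simp: g_def)
  moreover have "g c \<in> chains \<Delta> (Suc n)" if "c \<in> chains \<Delta> n" for c n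
    unfolding chains_def
  proof (intro CollectI allI impI)
    fix \<sigma> assume nz: "g c \<sigma> \<noteq> 0"
    have "card \<sigma> = Suc n"
    proof (rule ccontr)
      assume "card \<sigma> \<noteq> Suc n"
      then have "card \<sigma> = 0 \<or> pr (card \<sigma> - 1) c = (\<lambda>_. 0)"
        using chainsD(4)[OF that] by (auto simp: pr_def fun_eq_iff)
      then show False using nz by (auto simp: g_def linD(3)[OF g0(1)] split: if_splits)
    qed
    then show "\<sigma> \<in> \<Delta> \<and> card \<sigma> = Suc n"
      using nz g0(2) unfolding supported_def g_def by auto
  qed
  moreover have "bd W (g (bd W b)) = bd W b" if b: "b \<in> supported \<Delta>" for b
  proof
    fix \<tau>
    show "bd W (g (bd W b)) \<tau> = bd W b \<tau>"
    proof (cases "\<tau> \<in> \<Delta>")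
      case False
      have "bd W (g (bd W b)) \<in> supported \<Delta>" "bd W b \<in> supported \<Delta>"
        using \<open>\<And>c. g c \<in> supported \<Delta>\<close> b bd_supported[OF \<Delta>] by blast+
      then have "bd W (g (bd W b)) \<tau> = 0" "bd W b \<tau> = 0"
        using False unfolding supported_def by blast+
      then show ?thesis by simp
    next
      case True
      let ?m = "card \<tau>"
      have fin: "finite \<tau>" using complex_onD(3)[OF \<Delta> True] .
      \<comment> \<open>The boundary lowers the number of vertices by one, so it intertwines
        neighbouring degree projections.\<close>
      have pb: "pr ?m (bd W b) = bd W (pr (Suc ?m) b)"
      proof
        fix \<rho>
        show "pr ?m (bd W b) \<rho> = bd W (pr (Suc ?m) b) \<rho>"
        proof (cases "finite \<rho>")
          case True
          then show ?thesis by (auto simp: pr_def bd_def)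
        next
          case False
          then have "b (insert v \<rho>) = 0" for v
            using b complex_onD(3)[OF \<Delta>, of "insert v \<rho>"] by (auto simp: supported_def)
          then show ?thesis by (simp add: pr_def bd_def if_distrib cong: if_cong)
        qed
      qed
      \<comment> \<open>The boundary at \<open>\<tau>\<close> reads only faces with
        \<open>?m + 1\<close> vertices, where \<open>g\<close> coincides with \<open>g0\<close>
        applied to the \<open>?m\<close>-part.\<close>
      have "bd W (g (bd W b)) \<tau> = bd W (g0 (pr ?m (bd W b))) \<tau>"
        unfolding bd_def[of W "g _"] bd_def[of W "g0 _"]
        by (rule sum.cong) (use fin in \<open>auto simp: g_def\<close>)
      also have "\<dots> = bd W (pr (Suc ?m) b) \<tau>"
        unfolding pb by (subst g0(3)) (use b in \<open>auto simp: supported_def pr_def\<close>)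
      also have "\<dots> = bd W b \<tau>" unfolding pb[symmetric] by (simp add: pr_def)
      finally show ?thesis .
    qed
  qed
  ultimately show ?thesis using that by blast
qed

text \<open>\<open>h\<close> is a chain homotopy between the identity and \<open>p\<close>, and
  \<open>p\<close> maps into cycles and kills boundaries, so it models the projection onto homology.
  Both are linear operators on chains and can therefore be applied to one factor of a tensor
  product.\<close>

locale homology_contraction =
  fixes W :: "'a::linorder set" and \<Delta> :: "'a set set"
    and h p :: "('a set \<Rightarrow> 'k::field) \<Rightarrow> 'a set \<Rightarrow> 'k"
  assumes lin_h: "lin h" and lin_p: "lin p"
    and h_chains: "c \<in> chains \<Delta> n \<Longrightarrow> h c \<in> chains \<Delta> (Suc n)"
    and p_chains: "c \<in> chains \<Delta> n \<Longrightarrow> p c \<in> chains \<Delta> n"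
    and homotopy: "c \<in> supported \<Delta> \<Longrightarrow> bd W (h c) \<sigma> + h (bd W c) \<sigma> + p c \<sigma> = c \<sigma>"
    and bd_p: "c \<in> supported \<Delta> \<Longrightarrow> bd W (p c) = (\<lambda>_. 0)"
    and p_bd: "c \<in> supported \<Delta> \<Longrightarrow> p (bd W c) = (\<lambda>_. 0)"
    and p_eq_zero:
      "\<not> red_homology_nonzero TYPE('k) \<Delta> n \<Longrightarrow> c \<in> chains \<Delta> n \<Longrightarrow> p c = (\<lambda>_. 0)"

text \<open>With \<open>g\<close> a graded section of the boundary, \<open>u = 1 - g bd\<close> maps
  chains to cycles and fixes boundaries. Put \<open>h = g u\<close> and
  \<open>p = (1 - bd g) u\<close>; the factor \<open>1 - bd g\<close> annihilates boundaries, so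
  \<open>p\<close> is zero wherever all cycles bound.\<close>

lemma homology_contraction_exists:
  fixes \<Delta> :: "'a::linorder set set"
  assumes \<Delta>: "complex_on W \<Delta>"
  obtains h p :: "('a set \<Rightarrow> 'k::field) \<Rightarrow> 'a set \<Rightarrow> 'k"
  where "homology_contraction W \<Delta> h p"
proof -
  obtain g :: "('a set \<Rightarrow> 'k) \<Rightarrow> 'a set \<Rightarrow> 'k"
  where g: "lin g" "\<And>c. g c \<in> supported \<Delta>"
    "\<And>n c. c \<in> chains \<Delta> n \<Longrightarrow> g c \<in> chains \<Delta> (Suc n)"
    "\<And>b. b \<in> supported \<Delta> \<Longrightarrow> bd W (g (bd W b)) = bd W b"
    using bd_graded_section[OF \<Delta>] by blast
  define u where "u c = (\<lambda>\<sigma>. c \<sigma> - g (bd W c) \<sigma>)" for c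
  define h where "h c = g (u c)" for c
  define p where "p c = (\<lambda>\<sigma>. u c \<sigma> - bd W (g (u c)) \<sigma>)" for c
  note lg = linD[OF g(1)] and lb = linD[OF bd_lin[of W, where 'k = 'k]]
  have gbd: "g (bd W c) \<in> chains \<Delta> n" if "c \<in> chains \<Delta> n" for c n
  proof (cases n)
    \<comment> \<open>Degree 0 is outside the reach of \<open>bd_chains\<close>; its only possible
      face is empty and has zero boundary.\<close>
    case 0
    have "bd W c \<tau> = 0" for \<tau>
    proof -
      have "c (insert v \<tau>) = 0" for v
        using chainsD(1,2)[OF that] complex_onD(3)[OF \<Delta>] 0
        by (metis card_eq_0_iff insert_not_empty)
      then show ?thesis by (simp add: bd_def)
    qed
    then have "bd W c = (\<lambda>_. 0)" by auto
    then show ?thesis using lg(3) by (simp add: chains_def)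
  next
    case (Suc m)
    then show ?thesis using g(3)[OF bd_chains[OF \<Delta>]] that by blast
  qed
  have u_ch: "u c \<in> chains \<Delta> n" if "c \<in> chains \<Delta> n" for c n
    unfolding u_def by (intro chains_minus gbd that)
  have bu: "bd W (u c) = (\<lambda>_. 0)" if "c \<in> supported \<Delta>" for c
    unfolding u_def by (simp add: lb g(4)[OF that])
  have ub: "u (bd W c) = bd W c" if "c \<in> supported \<Delta>" for c
    unfolding u_def by (simp add: bd_bd[OF \<Delta> that] lg)
  have lu: "lin u" unfolding lin_def u_def by (auto simp: fun_eq_iff lg lb algebra_simps)
  have "homology_contraction W \<Delta> h p"
  proof
    show "lin h" unfolding lin_def h_def by (auto simp: linD[OF lu] lg)
    show "lin p" unfolding lin_def p_def by (auto simp: linD[OF lu] lg lb algebra_simps)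
    show "h c \<in> chains \<Delta> (Suc n)" if "c \<in> chains \<Delta> n" for n c
      unfolding h_def by (intro g(3) u_ch that)
    show "p c \<in> chains \<Delta> n" if "c \<in> chains \<Delta> n" for n c
      unfolding p_def by (intro chains_minus bd_chains[OF \<Delta>] g(3) u_ch that)
    show "bd W (h c) \<sigma> + h (bd W c) \<sigma> + p c \<sigma> = c \<sigma>" if "c \<in> supported \<Delta>" for c \<sigma>
      unfolding h_def p_def ub[OF that] by (simp add: u_def)
    show "bd W (p c) = (\<lambda>_. 0)" if "c \<in> supported \<Delta>" for c
      unfolding p_def by (simp add: lb bu[OF that] bd_bd[OF \<Delta> g(2)])
    show "p (bd W c) = (\<lambda>_. 0)" if "c \<in> supported \<Delta>" for c
      unfolding p_def ub[OF that] by (simp add: g(4)[OF that])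
    show "p c = (\<lambda>_. 0)" if nz: "\<not> red_homology_nonzero TYPE('k) \<Delta> n" and c: "c \<in> chains \<Delta> n" for n c
    proof -
      obtain b where b: "b \<in> chains \<Delta> (Suc n)" "u c = bd W b"
        using not_red_homology_nonzeroD[OF nz \<Delta> u_ch[OF c] bu[OF chains_supported[OF c]]] .
      show ?thesis unfolding p_def b(2) by (simp add: g(4)[OF chains_supported[OF b(1)]])
    qed
  qed
  then show ?thesis by (rule that)
qed

section \<open>Joins\<close>

definition simplicial_join :: "'a set set \<Rightarrow> 'a set set \<Rightarrow> 'a set set" where
  "simplicial_join \<Delta>\<^sub>1 \<Delta>\<^sub>2 = {\<sigma> \<union> \<tau> | \<sigma> \<tau>. \<sigma> \<in> \<Delta>\<^sub>1 \<and> \<tau> \<in> \<Delta>\<^sub>2}"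

text \<open>Elements of the tensor product of two chain complexes are written \<open>C \<tau> \<sigma>\<close> with
  \<open>\<sigma>\<close> a face of the first complex and \<open>\<tau>\<close> one of the second.  The Koszul sign sits on
  the boundary of the first factor, so that a linear operator acting on that factor
  needs no parity assumption.\<close>

definition bichains ::
    "'a set set \<Rightarrow> 'a set set \<Rightarrow> nat \<Rightarrow> ('a set \<Rightarrow> 'a set \<Rightarrow> 'k::field) set" where
  "bichains \<Delta>\<^sub>1 \<Delta>\<^sub>2 n =
    {C. \<forall>\<tau> \<sigma>. C \<tau> \<sigma> \<noteq> 0 \<longrightarrow> \<sigma> \<in> \<Delta>\<^sub>1 \<and> \<tau> \<in> \<Delta>\<^sub>2 \<and> card \<sigma> + card \<tau> = n}"

definition total_bd ::
    "'a::linorder set \<Rightarrow> 'a set \<Rightarrow> ('a set \<Rightarrow> 'a set \<Rightarrow> 'k::field) \<Rightarrow> 'a set \<Rightarrow> 'a set \<Rightarrow> 'k" where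
  "total_bd P Q C \<tau> \<sigma> = (-1) ^ card \<tau> * bd P (C \<tau>) \<sigma> + bd Q (\<lambda>\<tau>'. C \<tau>' \<sigma>) \<tau>"

text \<open>The sign of the permutation that sorts the vertices of \<open>\<tau>\<close> followed by those of \<open>\<sigma>\<close>.\<close>

definition shuffle_sign :: "'a::linorder set \<Rightarrow> 'a set \<Rightarrow> 'k::field" where
  "shuffle_sign \<sigma> \<tau> = (\<Prod>b\<in>\<tau>. bd_sign \<sigma> b)"

text \<open>The isomorphism from the tensor product to the chains of the join: a face splits into
  its parts in \<open>P\<close> and \<open>Q\<close>, and the sign compares the sorted orientation
  with the concatenated one.\<close>

definition glue ::
    "'a::linorder set \<Rightarrow> 'a set \<Rightarrow> ('a set \<Rightarrow> 'a set \<Rightarrow> 'k::field) \<Rightarrow> 'a set \<Rightarrow> 'k" where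
  "glue P Q C \<rho> =
    (if \<rho> \<subseteq> P \<union> Q then shuffle_sign (\<rho> \<inter> P) (\<rho> \<inter> Q) * C (\<rho> \<inter> Q) (\<rho> \<inter> P) else 0)"

section \<open>The chain complex of a join as a tensor product\<close>

lemma bd_sign_union:
  assumes "finite \<sigma>" "finite \<tau>" "\<sigma> \<inter> \<tau> = {}"
  shows "bd_sign (\<sigma> \<union> \<tau>) v = (bd_sign \<sigma> v * bd_sign \<tau> v :: 'k::field)"
proof -
  have "{u \<in> \<sigma> \<union> \<tau>. u < v} = {u \<in> \<sigma>. u < v} \<union> {u \<in> \<tau>. u < v}" by auto
  then have "card {u \<in> \<sigma> \<union> \<tau>. u < v} = card {u \<in> \<sigma>. u < v} + card {u \<in> \<tau>. u < v}"
    using assms by (metis (no_types, lifting) card_Un_disjoint disjoint_iff finite_Un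
      finite_subset mem_Collect_eq subsetI)
  then show ?thesis by (simp add: bd_sign_def power_add)
qed

lemma shuffle_sign_square: "shuffle_sign \<sigma> \<tau> * shuffle_sign \<sigma> \<tau> = (1 :: 'k::field)"
  by (simp add: shuffle_sign_def bd_sign_square flip: prod.distrib)

lemma shuffle_sign_insert_right:
  "finite \<tau> \<Longrightarrow> v \<notin> \<tau> \<Longrightarrow> shuffle_sign \<sigma> (insert v \<tau>) = bd_sign \<sigma> v * shuffle_sign \<sigma> \<tau>"
  by (simp add: shuffle_sign_def)

text \<open>The new vertex contributes a sign for each element of \<open>\<tau>\<close> above it. Up
  to parity their number is \<open>card \<tau>\<close> plus the number of elements below
  \<open>v\<close>.\<close>

lemma shuffle_sign_insert_left:
  assumes "finite \<sigma>" "v \<notin> \<sigma>" "finite \<tau>" "v \<notin> \<tau>"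
  shows "shuffle_sign (insert v \<sigma>) \<tau> =
    ((-1) ^ card \<tau> * bd_sign \<tau> v * shuffle_sign \<sigma> \<tau> :: 'k::field)"
  using assms(3,4)
proof (induction \<tau> rule: finite_induct)
  case empty
  then show ?case by (simp add: shuffle_sign_def bd_sign_def)
next
  case (insert b \<tau>)
  then have "shuffle_sign (insert v \<sigma>) (insert b \<tau>) =
      ((if v < b then -1 else 1) * bd_sign \<sigma> b) * ((-1) ^ card \<tau> * bd_sign \<tau> v * shuffle_sign \<sigma> \<tau> :: 'k)"
    using bd_sign_insert[OF assms(1,2), of b, where 'k = 'k]
    by (simp add: shuffle_sign_insert_right)
  moreover have "bd_sign (insert b \<tau>) v = ((if b < v then -1 else 1) * bd_sign \<tau> v :: 'k)"
    using bd_sign_insert insert by blast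
  moreover have "v < b \<longleftrightarrow> \<not> b < v" using insert by auto
  moreover have "card (insert b \<tau>) = Suc (card \<tau>)"
    "shuffle_sign \<sigma> (insert b \<tau>) = (bd_sign \<sigma> b * shuffle_sign \<sigma> \<tau> :: 'k)"
    using insert by (simp_all add: shuffle_sign_insert_right)
  ultimately show ?case by (simp only:) (simp add: mult_ac)
qed

text \<open>\<open>glue\<close> is a chain map. The vertices to insert are split between
  \<open>P\<close> and \<open>Q\<close>; in either case one sign occurs twice and cancels, and for
  \<open>P\<close> what remains is the Koszul sign \<open>(-1) ^ card \<tau>\<close>.\<close>

lemma bd_glue:
  fixes C :: "'a::linorder set \<Rightarrow> 'a set \<Rightarrow> 'k::field"
  assumes fin: "finite P" "finite Q" and disj: "P \<inter> Q = {}"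
  shows "bd (P \<union> Q) (glue P Q C) = glue P Q (total_bd P Q C)"
proof
  fix \<rho>
  show "bd (P \<union> Q) (glue P Q C) \<rho> = glue P Q (total_bd P Q C) \<rho>"
  proof (cases "\<rho> \<subseteq> P \<union> Q")
    case False
    then show ?thesis by (auto simp: bd_def glue_def intro!: sum.neutral)
  next
    case True
    define \<sigma> \<tau> where "\<sigma> = \<rho> \<inter> P" and "\<tau> = \<rho> \<inter> Q"
    have \<rho>: "\<rho> = \<sigma> \<union> \<tau>" and sub: "\<sigma> \<subseteq> P" "\<tau> \<subseteq> Q" and dis: "\<sigma> \<inter> \<tau> = {}"
      using True disj by (auto simp: \<sigma>_def \<tau>_def)
    have fins: "finite \<sigma>" "finite \<tau>" using sub fin finite_subset by blast+
    let ?t = "\<lambda>v. bd_sign \<rho> v * glue P Q C (insert v \<rho>)"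
    have "bd (P \<union> Q) (glue P Q C) \<rho> = sum ?t ((P - \<sigma>) \<union> (Q - \<tau>))"
      unfolding bd_def by (rule sum.cong) (use disj True in \<open>auto simp: \<sigma>_def \<tau>_def\<close>)
    also have "\<dots> = sum ?t (P - \<sigma>) + sum ?t (Q - \<tau>)"
      by (rule sum.union_disjoint) (use fin disj in auto)
    also have "sum ?t (P - \<sigma>) = shuffle_sign \<sigma> \<tau> * ((-1) ^ card \<tau> * bd P (C \<tau>) \<sigma>)"
      unfolding bd_def sum_distrib_left
    proof (intro sum.cong refl)
      fix v assume v: "v \<in> P - \<sigma>"
      then have "insert v \<rho> \<inter> P = insert v \<sigma>" "insert v \<rho> \<inter> Q = \<tau>" "insert v \<rho> \<subseteq> P \<union> Q" "v \<notin> \<tau>"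
        using True disj by (auto simp: \<sigma>_def \<tau>_def)
      then have "?t v = bd_sign \<sigma> v * bd_sign \<tau> v *
          (((-1) ^ card \<tau> * bd_sign \<tau> v * shuffle_sign \<sigma> \<tau>) * C \<tau> (insert v \<sigma>))"
        using v fins dis by (simp add: glue_def shuffle_sign_insert_left bd_sign_union \<rho>)
      also have "\<dots> = (bd_sign \<tau> v * bd_sign \<tau> v) *
          (shuffle_sign \<sigma> \<tau> * ((-1) ^ card \<tau> * (bd_sign \<sigma> v * C \<tau> (insert v \<sigma>))))"
        by (simp only: mult_ac)
      finally show "?t v = shuffle_sign \<sigma> \<tau> * ((-1) ^ card \<tau> * (bd_sign \<sigma> v * C \<tau> (insert v \<sigma>)))"
        by (simp add: bd_sign_square)
    qed
    also have "sum ?t (Q - \<tau>) = shuffle_sign \<sigma> \<tau> * bd Q (\<lambda>\<tau>'. C \<tau>' \<sigma>) \<tau>"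
      unfolding bd_def sum_distrib_left
    proof (intro sum.cong refl)
      fix v assume v: "v \<in> Q - \<tau>"
      then have "insert v \<rho> \<inter> Q = insert v \<tau>" "insert v \<rho> \<inter> P = \<sigma>" "insert v \<rho> \<subseteq> P \<union> Q"
        using True disj by (auto simp: \<sigma>_def \<tau>_def)
      then have "?t v = bd_sign \<sigma> v * bd_sign \<tau> v *
          ((bd_sign \<sigma> v * shuffle_sign \<sigma> \<tau>) * C (insert v \<tau>) \<sigma>)"
        using v fins dis by (simp add: glue_def shuffle_sign_insert_right bd_sign_union \<rho>)
      also have "\<dots> = (bd_sign \<sigma> v * bd_sign \<sigma> v) *
          (shuffle_sign \<sigma> \<tau> * (bd_sign \<tau> v * C (insert v \<tau>) \<sigma>))"
        by (simp only: mult_ac)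
      finally show "?t v = shuffle_sign \<sigma> \<tau> * (bd_sign \<tau> v * C (insert v \<tau>) \<sigma>)"
        by (simp add: bd_sign_square)
    qed
    finally have "bd (P \<union> Q) (glue P Q C) \<rho> = shuffle_sign \<sigma> \<tau> * total_bd P Q C \<tau> \<sigma>"
      by (simp only: total_bd_def distrib_left)
    then show ?thesis
      using True by (simp add: glue_def[of P Q "total_bd P Q C"] \<sigma>_def \<tau>_def)
  qed
qed

lemma complex_on_join:
  assumes "complex_on P \<Delta>\<^sub>1" "complex_on Q \<Delta>\<^sub>2"
  shows "complex_on (P \<union> Q) (simplicial_join \<Delta>\<^sub>1 \<Delta>\<^sub>2)"
  unfolding complex_on_def
proof (intro conjI ballI allI impI)
  show "finite (P \<union> Q)" using assms by (simp add: complex_on_def)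
  show "simplicial_join \<Delta>\<^sub>1 \<Delta>\<^sub>2 \<subseteq> Pow (P \<union> Q)"
    using assms unfolding complex_on_def simplicial_join_def by blast
next
  fix \<rho> \<rho>' assume "\<rho> \<in> simplicial_join \<Delta>\<^sub>1 \<Delta>\<^sub>2" and sub: "\<rho>' \<subseteq> \<rho>"
  then obtain \<sigma> \<tau> where "\<rho> = \<sigma> \<union> \<tau>" "\<sigma> \<in> \<Delta>\<^sub>1" "\<tau> \<in> \<Delta>\<^sub>2" unfolding simplicial_join_def by blast
  then have "\<rho>' = (\<rho>' \<inter> \<sigma>) \<union> (\<rho>' \<inter> \<tau>)" "\<rho>' \<inter> \<sigma> \<in> \<Delta>\<^sub>1" "\<rho>' \<inter> \<tau> \<in> \<Delta>\<^sub>2"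
    using sub complex_onD(4)[OF assms(1) \<open>\<sigma> \<in> \<Delta>\<^sub>1\<close>] complex_onD(4)[OF assms(2) \<open>\<tau> \<in> \<Delta>\<^sub>2\<close>]
    by auto
  then show "\<rho>' \<in> simplicial_join \<Delta>\<^sub>1 \<Delta>\<^sub>2" unfolding simplicial_join_def by blast
qed

lemma bichainsD:
  assumes "C \<in> bichains \<Delta>\<^sub>1 \<Delta>\<^sub>2 n" "C \<tau> \<sigma> \<noteq> 0"
  shows "\<sigma> \<in> \<Delta>\<^sub>1" "\<tau> \<in> \<Delta>\<^sub>2" "card \<sigma> + card \<tau> = n"
  using assms unfolding bichains_def by auto

text \<open>If \<open>card \<tau>\<close> exceeds \<open>n\<close> the row is zero, so the truncated
  subtraction is harmless.\<close>

lemma bichains_row: "C \<in> bichains \<Delta>\<^sub>1 \<Delta>\<^sub>2 n \<Longrightarrow> C \<tau> \<in> chains \<Delta>\<^sub>1 (n - card \<tau>)"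
  unfolding bichains_def chains_def by fastforce

lemma bichains_column: "C \<in> bichains \<Delta>\<^sub>1 \<Delta>\<^sub>2 n \<Longrightarrow> (\<lambda>\<tau>. C \<tau> \<sigma>) \<in> chains \<Delta>\<^sub>2 (n - card \<sigma>)"
  unfolding bichains_def chains_def by fastforce

lemma bichains_row_map:
  fixes C :: "'a set \<Rightarrow> 'a set \<Rightarrow> 'k::field"
  assumes "lin f" "\<And>m c. c \<in> chains \<Delta>\<^sub>1 m \<Longrightarrow> f c \<in> chains \<Delta>\<^sub>1 (m + k)" "C \<in> bichains \<Delta>\<^sub>1 \<Delta>\<^sub>2 n"
  shows "(\<lambda>\<tau>. f (C \<tau>)) \<in> bichains \<Delta>\<^sub>1 \<Delta>\<^sub>2 (n + k)"
  unfolding bichains_def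
proof (intro CollectI allI impI)
  fix \<tau> \<sigma> assume nz: "f (C \<tau>) \<sigma> \<noteq> 0"
  \<comment> \<open>By linearity a row with nonzero image is itself nonzero, which bounds
    \<open>card \<tau>\<close> by \<open>n\<close> and makes the subtraction below exact.\<close>
  then obtain \<sigma>' where "C \<tau> \<sigma>' \<noteq> 0" using linD(3)[OF assms(1)] by (metis ext)
  then have "\<tau> \<in> \<Delta>\<^sub>2" "card \<tau> \<le> n" using bichainsD[OF assms(3)] by fastforce+
  moreover have "f (C \<tau>) \<in> chains \<Delta>\<^sub>1 (n - card \<tau> + k)" by (intro assms(2) bichains_row[OF assms(3)])
  then have "\<sigma> \<in> \<Delta>\<^sub>1" "card \<sigma> = n - card \<tau> + k" using nz chainsD(1,2) by blast+
  ultimately show "\<sigma> \<in> \<Delta>\<^sub>1 \<and> \<tau> \<in> \<Delta>\<^sub>2 \<and> card \<sigma> + card \<tau> = n + k" by simp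
qed

lemma bichains_swap: "(\<lambda>\<sigma> \<tau>. C \<tau> \<sigma>) \<in> bichains \<Delta>\<^sub>2 \<Delta>\<^sub>1 n \<longleftrightarrow> C \<in> bichains \<Delta>\<^sub>1 \<Delta>\<^sub>2 n"
  unfolding bichains_def mem_Collect_eq by (subst all_comm, intro iff_allI) auto

text \<open>Transposition turns columns into rows.\<close>

lemma bichains_column_map:
  fixes C :: "'a set \<Rightarrow> 'a set \<Rightarrow> 'k::field"
  assumes "lin f" "\<And>m c. c \<in> chains \<Delta>\<^sub>2 m \<Longrightarrow> f c \<in> chains \<Delta>\<^sub>2 (m + k)" "C \<in> bichains \<Delta>\<^sub>1 \<Delta>\<^sub>2 n"
  shows "(\<lambda>\<tau> \<sigma>. f (\<lambda>\<tau>'. C \<tau>' \<sigma>) \<tau>) \<in> bichains \<Delta>\<^sub>1 \<Delta>\<^sub>2 (n + k)"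
proof -
  define F where "F \<tau> \<sigma> = f (\<lambda>\<tau>'. C \<tau>' \<sigma>) \<tau>" for \<tau> \<sigma>
  have "(\<lambda>\<sigma>. f (\<lambda>\<tau>'. C \<tau>' \<sigma>)) \<in> bichains \<Delta>\<^sub>2 \<Delta>\<^sub>1 (n + k)"
    by (rule bichains_row_map[OF assms(1,2) bichains_swap[of C, THEN iffD2, OF assms(3)]])
  then have "F \<in> bichains \<Delta>\<^sub>1 \<Delta>\<^sub>2 (n + k)"
    unfolding bichains_swap[of F, symmetric] by (simp add: F_def)
  then show ?thesis by (simp add: F_def[abs_def])
qed

lemma total_bd_bichains:
  assumes c: "complex_on P \<Delta>\<^sub>1" "complex_on Q \<Delta>\<^sub>2" and C: "C \<in> bichains \<Delta>\<^sub>1 \<Delta>\<^sub>2 (Suc n)"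
  shows "total_bd P Q C \<in> bichains \<Delta>\<^sub>1 \<Delta>\<^sub>2 n"
  unfolding bichains_def
proof (intro CollectI allI impI)
  fix \<tau> \<sigma> assume "total_bd P Q C \<tau> \<sigma> \<noteq> 0"
  then consider "bd P (C \<tau>) \<sigma> \<noteq> 0" | "bd Q (\<lambda>\<tau>'. C \<tau>' \<sigma>) \<tau> \<noteq> 0"
    unfolding total_bd_def by fastforce
  then show "\<sigma> \<in> \<Delta>\<^sub>1 \<and> \<tau> \<in> \<Delta>\<^sub>2 \<and> card \<sigma> + card \<tau> = n"
  proof cases
    case 1
    then obtain v where v: "v \<in> P - \<sigma>" "C \<tau> (insert v \<sigma>) \<noteq> 0" by (rule bd_nonzeroE)
    note b = bichainsD[OF C v(2)]
    then have "finite \<sigma>" using complex_onD(3)[OF c(1) b(1)] by simp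
    then show ?thesis using b v complex_onD(4)[OF c(1) b(1), of \<sigma>] by auto
  next
    case 2
    then obtain v where v: "v \<in> Q - \<tau>" "C (insert v \<tau>) \<sigma> \<noteq> 0" by (rule bd_nonzeroE)
    note b = bichainsD[OF C v(2)]
    then have "finite \<tau>" using complex_onD(3)[OF c(2) b(2)] by simp
    then show ?thesis using b v complex_onD(4)[OF c(2) b(2), of \<tau>] by auto
  qed
qed

lemma glue_chains:
  assumes c: "complex_on P \<Delta>\<^sub>1" "complex_on Q \<Delta>\<^sub>2" "P \<inter> Q = {}" and C: "C \<in> bichains \<Delta>\<^sub>1 \<Delta>\<^sub>2 n"
  shows "glue P Q C \<in> chains (simplicial_join \<Delta>\<^sub>1 \<Delta>\<^sub>2) n"
  unfolding chains_def
proof (intro CollectI allI impI)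
  fix \<rho> assume "glue P Q C \<rho> \<noteq> 0"
  then have \<rho>: "\<rho> \<subseteq> P \<union> Q" and nz: "C (\<rho> \<inter> Q) (\<rho> \<inter> P) \<noteq> 0"
    by (auto simp: glue_def split: if_splits)
  note b = bichainsD[OF C nz]
  have eq: "\<rho> = (\<rho> \<inter> P) \<union> (\<rho> \<inter> Q)" using \<rho> by auto
  have "card \<rho> = card (\<rho> \<inter> P) + card (\<rho> \<inter> Q)"
    by (subst eq, rule card_Un_disjoint)
      (use complex_onD(3)[OF c(1) b(1)] complex_onD(3)[OF c(2) b(2)] c(3) in auto)
  then show "\<rho> \<in> simplicial_join \<Delta>\<^sub>1 \<Delta>\<^sub>2 \<and> card \<rho> = n"
    using b eq unfolding simplicial_join_def by blast
qed

text \<open>Surjectivity of \<open>glue\<close>: a shuffle sign is its own inverse, so multiplying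
  by it recovers the tensor.\<close>

lemma chains_glueE:
  fixes c :: "'a::linorder set \<Rightarrow> 'k::field"
  assumes cx: "complex_on P \<Delta>\<^sub>1" "complex_on Q \<Delta>\<^sub>2" "P \<inter> Q = {}"
    and c: "c \<in> chains (simplicial_join \<Delta>\<^sub>1 \<Delta>\<^sub>2) n"
  obtains C where "C \<in> bichains \<Delta>\<^sub>1 \<Delta>\<^sub>2 n" "c = glue P Q C"
proof
  define C where
    "C \<tau> \<sigma> = (if \<sigma> \<subseteq> P \<and> \<tau> \<subseteq> Q then shuffle_sign \<sigma> \<tau> * c (\<sigma> \<union> \<tau>) else 0)" for \<tau> \<sigma>
  show "C \<in> bichains \<Delta>\<^sub>1 \<Delta>\<^sub>2 n"
    unfolding bichains_def
  proof (intro CollectI allI impI)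
    fix \<tau> \<sigma> assume "C \<tau> \<sigma> \<noteq> 0"
    then have sub: "\<sigma> \<subseteq> P" "\<tau> \<subseteq> Q" and nz: "c (\<sigma> \<union> \<tau>) \<noteq> 0"
      by (auto simp: C_def split: if_splits)
    obtain \<sigma>' \<tau>' where *: "\<sigma> \<union> \<tau> = \<sigma>' \<union> \<tau>'" "\<sigma>' \<in> \<Delta>\<^sub>1" "\<tau>' \<in> \<Delta>\<^sub>2"
      using chainsD(1)[OF c nz] unfolding simplicial_join_def by blast
    have "\<sigma>' \<subseteq> P" "\<tau>' \<subseteq> Q" using complex_onD(2) cx *(2,3) by blast+
    then have "\<sigma> = \<sigma>'" "\<tau> = \<tau>'" using sub cx(3) *(1) by blast+
    moreover have "card (\<sigma> \<union> \<tau>) = card \<sigma> + card \<tau>"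
      by (rule card_Un_disjoint)
        (use sub cx(3) complex_onD(1)[OF cx(1)] complex_onD(1)[OF cx(2)] finite_subset in blast)+
    ultimately show "\<sigma> \<in> \<Delta>\<^sub>1 \<and> \<tau> \<in> \<Delta>\<^sub>2 \<and> card \<sigma> + card \<tau> = n"
      using * chainsD(2)[OF c nz] by simp
  qed
  show "c = glue P Q C"
  proof
    fix \<rho>
    show "c \<rho> = glue P Q C \<rho>"
    proof (cases "\<rho> \<subseteq> P \<union> Q")
      case True
      then have "(\<rho> \<inter> P) \<union> (\<rho> \<inter> Q) = \<rho>" by auto
      then show ?thesis
        using True shuffle_sign_square[of "\<rho> \<inter> P" "\<rho> \<inter> Q", where 'k = 'k]
        by (simp add: glue_def C_def flip: mult.assoc)
    next
      case False
      then have "\<rho> \<notin> simplicial_join \<Delta>\<^sub>1 \<Delta>\<^sub>2"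
        using complex_onD(2)[OF complex_on_join[OF cx(1,2)]] by blast
      then show ?thesis using False chainsD(3)[OF c] by (simp add: glue_def)
    qed
  qed
qed

text \<open>As \<open>P\<close> and \<open>Q\<close> are disjoint, a face of the join determines its
  two parts, so every entry can be read off from the glued chain.\<close>

lemma glue_inject:
  fixes C D :: "'a::linorder set \<Rightarrow> 'a set \<Rightarrow> 'k::field"
  assumes cx: "complex_on P \<Delta>\<^sub>1" "complex_on Q \<Delta>\<^sub>2" "P \<inter> Q = {}"
    and CD: "C \<in> bichains \<Delta>\<^sub>1 \<Delta>\<^sub>2 n" "D \<in> bichains \<Delta>\<^sub>1 \<Delta>\<^sub>2 n" and eq: "glue P Q C = glue P Q D"
  shows "C = D"
proof (intro ext)
  fix \<tau> \<sigma>
  show "C \<tau> \<sigma> = D \<tau> \<sigma>"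
  proof (cases "\<sigma> \<in> \<Delta>\<^sub>1 \<and> \<tau> \<in> \<Delta>\<^sub>2")
    case False
    then show ?thesis using bichainsD[OF CD(1)] bichainsD[OF CD(2)] by metis
  next
    case True
    then have "\<sigma> \<subseteq> P" "\<tau> \<subseteq> Q" using complex_onD(2) cx by blast+
    then have "(\<sigma> \<union> \<tau>) \<inter> P = \<sigma>" "(\<sigma> \<union> \<tau>) \<inter> Q = \<tau>" "\<sigma> \<union> \<tau> \<subseteq> P \<union> Q" using cx(3) by auto
    then have "shuffle_sign \<sigma> \<tau> * C \<tau> \<sigma> = shuffle_sign \<sigma> \<tau> * D \<tau> \<sigma>"
      using fun_cong[OF eq, of "\<sigma> \<union> \<tau>"] by (simp add: glue_def)
    moreover have "shuffle_sign \<sigma> \<tau> \<noteq> (0 :: 'k)"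
      using shuffle_sign_square[of \<sigma> \<tau>, where 'k = 'k] by auto
    ultimately show ?thesis by simp
  qed
qed

text \<open>Cycles and boundaries are transported along the isomorphism \<open>glue\<close>, so that
  the Kuenneth arguments can work with tensors alone.\<close>

lemma join_homology_iff:
  fixes \<Delta>\<^sub>1 :: "'a::linorder set set"
  assumes cx: "complex_on P \<Delta>\<^sub>1" "complex_on Q \<Delta>\<^sub>2" "P \<inter> Q = {}"
  shows "red_homology_nonzero TYPE('k::field) (simplicial_join \<Delta>\<^sub>1 \<Delta>\<^sub>2) n \<longleftrightarrow>
    (\<exists>C :: 'a set \<Rightarrow> 'a set \<Rightarrow> 'k. C \<in> bichains \<Delta>\<^sub>1 \<Delta>\<^sub>2 n \<and> total_bd P Q C = (\<lambda>_ _. 0) \<and>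
      (\<forall>B \<in> bichains \<Delta>\<^sub>1 \<Delta>\<^sub>2 (Suc n). C \<noteq> total_bd P Q B))" (is "?L \<longleftrightarrow> ?R")
proof -
  note fin = complex_onD(1)[OF cx(1)] complex_onD(1)[OF cx(2)]
  note bdg = bd_glue[OF fin cx(3)]
  note hiff = red_homology_nonzero_iff[OF complex_on_join[OF cx(1,2)]]
  have glue0: "glue P Q (\<lambda>_ _. 0) = (\<lambda>_. 0 :: 'k)" by (simp add: glue_def fun_eq_iff)
  show ?thesis
  proof
    assume ?L
    then obtain c :: "'a set \<Rightarrow> 'k" where c: "c \<in> chains (simplicial_join \<Delta>\<^sub>1 \<Delta>\<^sub>2) n"
        "bd (P \<union> Q) c = (\<lambda>_. 0)"
        "\<And>b. b \<in> chains (simplicial_join \<Delta>\<^sub>1 \<Delta>\<^sub>2) (Suc n) \<Longrightarrow> c \<noteq> bd (P \<union> Q) b"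
      using hiff by blast
    obtain C where C: "C \<in> bichains \<Delta>\<^sub>1 \<Delta>\<^sub>2 n" "c = glue P Q C" using chains_glueE[OF cx c(1)] .
    have g0: "glue P Q (total_bd P Q C) = (\<lambda>_. 0)" using c(2) C(2) bdg by metis
    \<comment> \<open>\<open>glue\<close> reads only entries on subsets of \<open>P\<close> and
      \<open>Q\<close>; the others vanish because the total boundary is supported on pairs of
      faces.\<close>
    have "total_bd P Q C \<tau> \<sigma> = 0" for \<tau> \<sigma>
    proof (rule ccontr)
      assume nz: "total_bd P Q C \<tau> \<sigma> \<noteq> 0"
      have "\<sigma> \<in> \<Delta>\<^sub>1 \<and> \<tau> \<in> \<Delta>\<^sub>2"
      proof (cases n)
        case (Suc m)
        then show ?thesis using bichainsD[OF total_bd_bichains[OF cx(1,2)]] C(1) nz by blast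
      next
        \<comment> \<open>\<open>total_bd_bichains\<close> needs a successor degree, but in degree 0
          every entry with an inserted vertex is zero.\<close>
        case 0
        have "C \<tau> (insert v \<sigma>) = 0" "C (insert v \<tau>) \<sigma> = 0" for v
          using bichainsD[OF C(1)] complex_onD(3)[OF cx(1)] complex_onD(3)[OF cx(2)] 0
          by (metis add_is_0 card_eq_0_iff insert_not_empty)+
        then have "total_bd P Q C \<tau> \<sigma> = 0" by (simp add: total_bd_def bd_def)
        then show ?thesis using nz by simp
      qed
      then have "\<sigma> \<subseteq> P" "\<tau> \<subseteq> Q" using complex_onD(2) cx by blast+
      then have "(\<sigma> \<union> \<tau>) \<inter> P = \<sigma>" "(\<sigma> \<union> \<tau>) \<inter> Q = \<tau>" "\<sigma> \<union> \<tau> \<subseteq> P \<union> Q" using cx(3) by auto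
      then have "shuffle_sign \<sigma> \<tau> * total_bd P Q C \<tau> \<sigma> = 0"
        using fun_cong[OF g0, of "\<sigma> \<union> \<tau>"] by (simp add: glue_def)
      then show False
        using nz shuffle_sign_square[of \<sigma> \<tau>, where 'k = 'k] by auto
    qed
    moreover have "C \<noteq> total_bd P Q B" if "B \<in> bichains \<Delta>\<^sub>1 \<Delta>\<^sub>2 (Suc n)" for B
      using c(3)[OF glue_chains[OF cx that]] C(2) bdg by metis
    ultimately show ?R using C(1) by blast
  next
    assume ?R
    then obtain C :: "'a set \<Rightarrow> 'a set \<Rightarrow> 'k" where C: "C \<in> bichains \<Delta>\<^sub>1 \<Delta>\<^sub>2 n"
        "total_bd P Q C = (\<lambda>_ _. 0)"
        "\<And>B. B \<in> bichains \<Delta>\<^sub>1 \<Delta>\<^sub>2 (Suc n) \<Longrightarrow> C \<noteq> total_bd P Q B"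
      by blast
    have "glue P Q C \<noteq> bd (P \<union> Q) b" if b: "b \<in> chains (simplicial_join \<Delta>\<^sub>1 \<Delta>\<^sub>2) (Suc n)" for b
    proof
      assume eq: "glue P Q C = bd (P \<union> Q) b"
      obtain B where B: "B \<in> bichains \<Delta>\<^sub>1 \<Delta>\<^sub>2 (Suc n)" "b = glue P Q B"
        using chains_glueE[OF cx b] .
      then have "C = total_bd P Q B"
        using glue_inject[OF cx C(1) total_bd_bichains[OF cx(1,2) B(1)]] eq bdg by metis
      then show False using C(3) B(1) by blast
    qed
    moreover have "bd (P \<union> Q) (glue P Q C) = (\<lambda>_. 0)" using bdg C(2) glue0 by metis
    ultimately show ?L using hiff glue_chains[OF cx C(1)] by blast
  qed
qed

section \<open>The Kuenneth formula\<close>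

text \<open>Operators on different tensor factors commute: \<open>bd Q\<close> is a linear
  combination of evaluations in the second variable.\<close>

lemma bd_row_map:
  assumes "lin f"
  shows "bd Q (\<lambda>\<tau>'. f (C \<tau>') \<sigma>) \<tau> = f (\<lambda>\<sigma>'. bd Q (\<lambda>\<tau>'. C \<tau>' \<sigma>') \<tau>) \<sigma>"
  unfolding bd_def by (simp add: lin_sum[OF assms])

text \<open>One more vertex flips the parity, so the twist turns commuting operators into
  anticommuting ones.\<close>

lemma bd_sign_twist:
  fixes X :: "'a::linorder set \<Rightarrow> 'k::field"
  assumes "finite \<tau>"
  shows "bd Q (\<lambda>\<tau>'. (-1) ^ card \<tau>' * X \<tau>') \<tau> = - ((-1) ^ card \<tau>) * bd Q X \<tau>"
  unfolding bd_def sum_distrib_left by (intro sum.cong refl) (use assms in auto)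

text \<open>The tensor product of nonbounding cycles \<open>a\<close> and \<open>b\<close> does not
  bound. Applying \<open>p\<close> to the first factor of a bounding tensor removes the
  \<open>bd P\<close> part and exhibits a nonzero multiple of \<open>b\<close> as a
  boundary.\<close>

theorem join_homology_nonzeroI:
  fixes \<Delta>\<^sub>1 :: "'a::linorder set set"
  assumes cx: "complex_on P \<Delta>\<^sub>1" "complex_on Q \<Delta>\<^sub>2" "P \<inter> Q = {}"
    and h: "red_homology_nonzero TYPE('k::field) \<Delta>\<^sub>1 i" "red_homology_nonzero TYPE('k) \<Delta>\<^sub>2 j"
  shows "red_homology_nonzero TYPE('k) (simplicial_join \<Delta>\<^sub>1 \<Delta>\<^sub>2) (i + j)"
proof -
  obtain a :: "'a set \<Rightarrow> 'k" where a: "a \<in> chains \<Delta>\<^sub>1 i" "bd P a = (\<lambda>_. 0)"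
      "\<And>b. b \<in> chains \<Delta>\<^sub>1 (Suc i) \<Longrightarrow> a \<noteq> bd P b"
    using h(1) red_homology_nonzero_iff[OF cx(1)] by blast
  obtain b :: "'a set \<Rightarrow> 'k" where b: "b \<in> chains \<Delta>\<^sub>2 j" "bd Q b = (\<lambda>_. 0)"
      "\<And>b'. b' \<in> chains \<Delta>\<^sub>2 (Suc j) \<Longrightarrow> b \<noteq> bd Q b'"
    using h(2) red_homology_nonzero_iff[OF cx(2)] by blast
  obtain H p :: "('a set \<Rightarrow> 'k) \<Rightarrow> 'a set \<Rightarrow> 'k"
    where "homology_contraction P \<Delta>\<^sub>1 H p"
    using homology_contraction_exists[OF cx(1)] .
  then interpret A: homology_contraction P \<Delta>\<^sub>1 H p .
  have "\<exists>\<sigma>. p a \<sigma> \<noteq> 0"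
  proof (rule ccontr)
    assume "\<not> ?thesis"
    \<comment> \<open>For a cycle with \<open>p a = 0\<close> the homotopy identity reduces to this
      equation.\<close>
    then have "a = bd P (H a)"
      using A.homotopy[OF chains_supported[OF a(1)]] a(2) linD(3)[OF A.lin_h] by (intro ext) (simp add: fun_eq_iff)
    then show False using a(3) A.h_chains[OF a(1)] by blast
  qed
  then obtain \<sigma>0 where s0: "p a \<sigma>0 \<noteq> 0" by blast
  define C where "C \<tau> = (\<lambda>\<sigma>. b \<tau> * a \<sigma>)" for \<tau>
  have C_ch: "C \<in> bichains \<Delta>\<^sub>1 \<Delta>\<^sub>2 (i + j)"
    using chainsD(1,2)[OF a(1)] chainsD(1,2)[OF b(1)] by (auto simp: bichains_def C_def)
  have "bd Q (\<lambda>\<tau>'. b \<tau>' * a \<sigma>) \<tau> = a \<sigma> * bd Q b \<tau>" for \<sigma> \<tau>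
    using bd_scale[of Q "a \<sigma>" b] by (simp add: mult.commute)
  then have C_cyc: "total_bd P Q C = (\<lambda>_ _. 0)"
    by (simp add: fun_eq_iff total_bd_def C_def bd_scale a(2) b(2))
  have "C \<noteq> total_bd P Q F" if F: "F \<in> bichains \<Delta>\<^sub>1 \<Delta>\<^sub>2 (Suc (i + j))" for F
  proof
    assume eq: "C = total_bd P Q F"
    \<comment> \<open>Taking the coefficient of \<open>p\<close> at \<open>\<sigma>0\<close> is a
      functional that vanishes on boundaries but not on \<open>a\<close>; it is applied to each row
      of \<open>F\<close>.\<close>
    define f where "f \<tau> = p (F \<tau>) \<sigma>0" for \<tau>
    have "f \<in> chains \<Delta>\<^sub>2 (Suc (i + j) - card \<sigma>0)"
      unfolding f_def
      using bichains_column[OF bichains_row_map[OF A.lin_p _ F, of 0]] A.p_chains by simp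
    moreover have "card \<sigma>0 = i" using chainsD(2)[OF A.p_chains[OF a(1)] s0] .
    ultimately have f_ch: "f \<in> chains \<Delta>\<^sub>2 (Suc j)" by simp
    have "p a \<sigma>0 * b \<tau> = bd Q f \<tau>" for \<tau>
    proof -
      have "p a \<sigma>0 * b \<tau> = p (C \<tau>) \<sigma>0" by (simp add: C_def linD(2)[OF A.lin_p])
      also have "C \<tau> = (\<lambda>\<sigma>. (-1) ^ card \<tau> * bd P (F \<tau>) \<sigma> + bd Q (\<lambda>\<tau>'. F \<tau>' \<sigma>) \<tau>)"
        by (simp add: eq total_bd_def fun_eq_iff)
      also have "p \<dots> \<sigma>0 = p (\<lambda>\<sigma>. bd Q (\<lambda>\<tau>'. F \<tau>' \<sigma>) \<tau>) \<sigma>0"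
        using A.p_bd[OF chains_supported[OF bichains_row[OF F]]]
        by (simp add: linD(1,2)[OF A.lin_p])
      also have "\<dots> = bd Q f \<tau>" unfolding f_def by (rule bd_row_map[OF A.lin_p, symmetric])
      finally show ?thesis .
    qed
    then have "b = bd Q (\<lambda>\<tau>. inverse (p a \<sigma>0) * f \<tau>)"
      unfolding bd_scale using s0 by (simp add: fun_eq_iff field_simps flip: \<open>\<And>\<tau>. _ = bd Q f \<tau>\<close>)
    moreover have "(\<lambda>\<tau>. inverse (p a \<sigma>0) * f \<tau>) \<in> chains \<Delta>\<^sub>2 (Suc j)"
      using f_ch by (auto simp: chains_def)
    ultimately show False using b(3) by blast
  qed
  then show ?thesis unfolding join_homology_iff[OF cx] using C_ch C_cyc by blast
qed

text \<open>Suppose no pair of degrees works. Up to a boundary, a total cycle can be replaced by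
  \<open>p\<close> applied to its rows. A nonzero entry of the result forces homology of
  \<open>\<Delta>\<^sub>1\<close> in its degree, hence none of \<open>\<Delta>\<^sub>2\<close> in
  the complementary degree, and so every column bounds.\<close>

theorem join_homology_nonzeroD:
  fixes \<Delta>\<^sub>1 :: "'a::linorder set set"
  assumes cx: "complex_on P \<Delta>\<^sub>1" "complex_on Q \<Delta>\<^sub>2" "P \<inter> Q = {}"
    and h: "red_homology_nonzero TYPE('k::field) (simplicial_join \<Delta>\<^sub>1 \<Delta>\<^sub>2) n"
  shows "\<exists>i j. i + j = n \<and> red_homology_nonzero TYPE('k) \<Delta>\<^sub>1 i \<and>
    red_homology_nonzero TYPE('k) \<Delta>\<^sub>2 j"
proof (rule ccontr)
  assume "\<not> ?thesis"
  then have none: "\<not> red_homology_nonzero TYPE('k) \<Delta>\<^sub>2 j"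
    if "red_homology_nonzero TYPE('k) \<Delta>\<^sub>1 i" "i + j = n" for i j
    using that by blast
  obtain C :: "'a set \<Rightarrow> 'a set \<Rightarrow> 'k" where C: "C \<in> bichains \<Delta>\<^sub>1 \<Delta>\<^sub>2 n"
      "total_bd P Q C = (\<lambda>_ _. 0)"
      "\<And>B. B \<in> bichains \<Delta>\<^sub>1 \<Delta>\<^sub>2 (Suc n) \<Longrightarrow> C \<noteq> total_bd P Q B"
    using h unfolding join_homology_iff[OF cx] by blast
  obtain H p :: "('a set \<Rightarrow> 'k) \<Rightarrow> 'a set \<Rightarrow> 'k"
    where "homology_contraction P \<Delta>\<^sub>1 H p"
    using homology_contraction_exists[OF cx(1)] .
  then interpret A: homology_contraction P \<Delta>\<^sub>1 H p .
  obtain H' p' :: "('a set \<Rightarrow> 'k) \<Rightarrow> 'a set \<Rightarrow> 'k"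
    where "homology_contraction Q \<Delta>\<^sub>2 H' p'"
    using homology_contraction_exists[OF cx(2)] .
  then interpret B: homology_contraction Q \<Delta>\<^sub>2 H' p' .
  define C' where "C' \<tau> = p (C \<tau>)" for \<tau>
  have C'_ch: "C' \<in> bichains \<Delta>\<^sub>1 \<Delta>\<^sub>2 n"
    unfolding C'_def using bichains_row_map[OF A.lin_p _ C(1), of 0] A.p_chains by simp
  have row_supp: "C \<tau> \<in> supported \<Delta>\<^sub>1" for \<tau>
    by (rule chains_supported[OF bichains_row[OF C(1)]])
  have col_supp: "(\<lambda>\<tau>. C' \<tau> \<sigma>) \<in> supported \<Delta>\<^sub>2" for \<sigma>
    by (rule chains_supported[OF bichains_column[OF C'_ch]])
  have row: "(\<lambda>\<sigma>. bd Q (\<lambda>\<tau>'. C \<tau>' \<sigma>) \<tau>) = (\<lambda>\<sigma>. - ((-1) ^ card \<tau>) * bd P (C \<tau>) \<sigma>)" for \<tau>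
  proof
    fix \<sigma>
    have "(-1) ^ card \<tau> * bd P (C \<tau>) \<sigma> + bd Q (\<lambda>\<tau>'. C \<tau>' \<sigma>) \<tau> = 0"
      using C(2) by (metis total_bd_def)
    then show "bd Q (\<lambda>\<tau>'. C \<tau>' \<sigma>) \<tau> = - ((-1) ^ card \<tau>) * bd P (C \<tau>) \<sigma>"
      by (simp add: eq_neg_iff_add_eq_0 add.commute)
  qed
  \<comment> \<open>In a total cycle \<open>bd Q\<close> equals \<open>bd P\<close> up to sign, and
    \<open>p\<close> kills the latter.\<close>
  have col_cyc: "bd Q (\<lambda>\<tau>. C' \<tau> \<sigma>) = (\<lambda>_. 0)" for \<sigma>
    unfolding C'_def fun_eq_iff bd_row_map[OF A.lin_p] row linD(2)[OF A.lin_p] A.p_bd[OF row_supp]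
    by simp
  have p'0: "p' (\<lambda>\<tau>. C' \<tau> \<sigma>) = (\<lambda>_. 0)" for \<sigma>
  proof (cases "\<forall>\<tau>. C' \<tau> \<sigma> = 0")
    case True
    then show ?thesis using linD(3)[OF B.lin_p] by simp
  next
    case False
    then obtain \<tau> where nz: "C' \<tau> \<sigma> \<noteq> 0" by blast
    have card: "card \<sigma> + card \<tau> = n" using bichainsD(3)[OF C'_ch nz] .
    have "red_homology_nonzero TYPE('k) \<Delta>\<^sub>1 (n - card \<tau>)"
      using A.p_eq_zero[OF _ bichains_row[OF C(1)], of \<tau>] nz unfolding C'_def by fastforce
    then have "\<not> red_homology_nonzero TYPE('k) \<Delta>\<^sub>2 (n - card \<sigma>)"
      using none[of "card \<sigma>" "card \<tau>"] card by auto
    then show ?thesis using B.p_eq_zero bichains_column[OF C'_ch] by blast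
  qed
  \<comment> \<open>The first term moves \<open>C\<close> to \<open>C'\<close>, its sign cancelling
    the Koszul sign; the second bounds the columns of \<open>C'\<close>.\<close>
  define B where "B \<tau> \<sigma> = (-1) ^ card \<tau> * H (C \<tau>) \<sigma> + H' (\<lambda>\<tau>'. C' \<tau>' \<sigma>) \<tau>" for \<tau> \<sigma>
  have B_ch: "B \<in> bichains \<Delta>\<^sub>1 \<Delta>\<^sub>2 (Suc n)"
  proof -
    have "(\<lambda>\<tau>. H (C \<tau>)) \<in> bichains \<Delta>\<^sub>1 \<Delta>\<^sub>2 (n + 1)"
      by (rule bichains_row_map[OF A.lin_h _ C(1)]) (simp add: A.h_chains)
    moreover have "(\<lambda>\<tau> \<sigma>. H' (\<lambda>\<tau>'. C' \<tau>' \<sigma>) \<tau>) \<in> bichains \<Delta>\<^sub>1 \<Delta>\<^sub>2 (n + 1)"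
      by (rule bichains_column_map[OF B.lin_h _ C'_ch]) (simp add: B.h_chains)
    ultimately show ?thesis unfolding bichains_def B_def by simp (metis add_cancel_right_left mult_zero_right)
  qed
  have "C \<tau> \<sigma> = total_bd P Q B \<tau> \<sigma>" for \<tau> \<sigma>
  proof (cases "\<tau> \<in> \<Delta>\<^sub>2")
    case False
    then show ?thesis
      using bichainsD(2)[OF C(1)] bichainsD(2)[OF total_bd_bichains[OF cx(1,2) B_ch]] by metis
  next
    case True
    then have fin: "finite \<tau>" using complex_onD(3)[OF cx(2)] by blast
    let ?s = "(-1) ^ card \<tau> :: 'k"
    have ss: "?s * ?s = 1" by (simp flip: power_add)
    have "bd P (B \<tau>) \<sigma> = ?s * bd P (H (C \<tau>)) \<sigma> + bd P (\<lambda>\<sigma>'. H' (\<lambda>\<tau>'. C' \<tau>' \<sigma>') \<tau>) \<sigma>"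
      unfolding B_def bd_add bd_scale by simp
    also have "bd P (\<lambda>\<sigma>'. H' (\<lambda>\<tau>'. C' \<tau>' \<sigma>') \<tau>) \<sigma> = H' (\<lambda>\<tau>'. bd P (C' \<tau>') \<sigma>) \<tau>"
      by (rule bd_row_map[OF B.lin_h])
    also have "\<dots> = 0"
      unfolding C'_def A.bd_p[OF row_supp] linD(3)[OF B.lin_h] by simp
    finally have 1: "bd P (B \<tau>) \<sigma> = ?s * bd P (H (C \<tau>)) \<sigma>" by simp
    have "bd Q (\<lambda>\<tau>'. B \<tau>' \<sigma>) \<tau> =
        - ?s * bd Q (\<lambda>\<tau>'. H (C \<tau>') \<sigma>) \<tau> + bd Q (H' (\<lambda>\<tau>'. C' \<tau>' \<sigma>)) \<tau>"
      unfolding B_def bd_add bd_sign_twist[OF fin] by simp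
    also have "bd Q (\<lambda>\<tau>'. H (C \<tau>') \<sigma>) \<tau> = - ?s * H (bd P (C \<tau>)) \<sigma>"
      unfolding bd_row_map[OF A.lin_h] row linD(2)[OF A.lin_h] ..
    also have "bd Q (H' (\<lambda>\<tau>'. C' \<tau>' \<sigma>)) \<tau> = C' \<tau> \<sigma>"
      using B.homotopy[OF col_supp, of \<sigma> \<tau>] col_cyc[of \<sigma>] p'0[of \<sigma>] linD(3)[OF B.lin_h] by simp
    finally have 2: "bd Q (\<lambda>\<tau>'. B \<tau>' \<sigma>) \<tau> = H (bd P (C \<tau>)) \<sigma> + C' \<tau> \<sigma>"
      using ss by (simp flip: mult.assoc)
    \<comment> \<open>The three terms left are those of the homotopy identity for the row
      \<open>C \<tau>\<close>.\<close>
    show ?thesis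
      unfolding total_bd_def 1 2 using A.homotopy[OF row_supp, of \<tau> \<sigma>] ss
      by (simp add: C'_def add.assoc flip: mult.assoc)
  qed
  then have "C = total_bd P Q B" by (intro ext)
  then show False using C(3)[OF B_ch] by blast
qed

section \<open>Independence complexes\<close>

lemma complex_on_Ind: "finite S \<Longrightarrow> complex_on S (Ind E S)"
  unfolding complex_on_def Ind_def by auto

lemma simple_graph_no_loop: "simple_graph V E \<Longrightarrow> {v} \<notin> E"
  unfolding simple_graph_def by (metis insert_absorb2 doubleton_eq_iff)

lemma simple_graph_edgeD: "simple_graph V E \<Longrightarrow> {u, v} \<in> E \<Longrightarrow> u \<noteq> v \<and> u \<in> V \<and> v \<in> V"
  unfolding simple_graph_def by (metis doubleton_eq_iff)

lemma Ind_Un: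
  assumes "\<And>u v. u \<in> P \<Longrightarrow> v \<in> Q \<Longrightarrow> {u, v} \<notin> E"
  shows "Ind E (P \<union> Q) = simplicial_join (Ind E P) (Ind E Q)"
proof (intro set_eqI iffI)
  fix \<rho> assume "\<rho> \<in> Ind E (P \<union> Q)"
  then have "\<rho> = (\<rho> \<inter> P) \<union> (\<rho> \<inter> Q)" "\<rho> \<inter> P \<in> Ind E P" "\<rho> \<inter> Q \<in> Ind E Q"
    by (auto simp: Ind_def)
  then show "\<rho> \<in> simplicial_join (Ind E P) (Ind E Q)" unfolding simplicial_join_def by blast
next
  fix \<rho> assume "\<rho> \<in> simplicial_join (Ind E P) (Ind E Q)"
  then obtain \<sigma> \<tau> where "\<rho> = \<sigma> \<union> \<tau>" and "\<sigma> \<in> Ind E P" "\<tau> \<in> Ind E Q"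
    unfolding simplicial_join_def by blast
  moreover have "{v, u} \<notin> E" if "u \<in> P" "v \<in> Q" for u v
    using assms[OF that] by (simp add: insert_commute)
  ultimately show "\<rho> \<in> Ind E (P \<union> Q)" using assms unfolding Ind_def by blast
qed

text \<open>Induced subgraphs need no edge set of their own, since \<open>Ind E S\<close> sees only
  edges inside \<open>S\<close>.\<close>

abbreviation ind_homology :: "'k::field itself \<Rightarrow> 'a::linorder set set \<Rightarrow> 'a set \<Rightarrow> nat \<Rightarrow> bool" where
  "ind_homology K E S n \<equiv> red_homology_nonzero K (Ind E S) n"

context
  fixes V :: "'a::linorder set" and E :: "'a set set"
  assumes simple: "simple_graph V E"
begin

lemma finite_V: "finite V"
  using simple by (simp add: simple_graph_def)

text \<open>In an independence complex, deleting a vertex removes \<open>y\<close> from the graph,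
  while its link is the independence complex after removal of the closed neighbourhood of
  \<open>y\<close>.\<close>

lemma homology_deletion:
  assumes "S \<subseteq> V" "y \<in> S" "ind_homology TYPE('k::field) E S (Suc n)"
  shows "ind_homology TYPE('k) E (S - {y}) (Suc n) \<or>
    ind_homology TYPE('k) E (S - {y} - {u. {u, y} \<in> E}) n"
proof -
  have "finite S" using assms(1) finite_V finite_subset by blast
  moreover have "{\<sigma> \<in> Ind E S. y \<notin> \<sigma>} = Ind E (S - {y})" by (auto simp: Ind_def)
  moreover have "{\<sigma>. y \<notin> \<sigma> \<and> insert y \<sigma> \<in> Ind E S} = Ind E (S - {y} - {u. {u, y} \<in> E})"
    using assms(2) simple_graph_no_loop[OF simple]
    by (auto simp: Ind_def insert_commute)
  ultimately show ?thesis
    using deletion_or_link_homology[OF complex_on_Ind assms(3), of y] by simp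
qed

lemma homology_disjoint_UnI:
  assumes "P \<subseteq> V" "Q \<subseteq> V" "P \<inter> Q = {}" "\<And>u v. u \<in> P \<Longrightarrow> v \<in> Q \<Longrightarrow> {u, v} \<notin> E"
    and "ind_homology TYPE('k::field) E P i" "ind_homology TYPE('k) E Q j"
  shows "ind_homology TYPE('k) E (P \<union> Q) (i + j)"
proof -
  have "finite P" "finite Q" using assms(1,2) finite_V finite_subset by blast+
  then show ?thesis
    using join_homology_nonzeroI[OF complex_on_Ind complex_on_Ind assms(3,5,6)] Ind_Un[OF assms(4)]
    by simp
qed

lemma homology_disjoint_UnD:
  assumes "P \<subseteq> V" "Q \<subseteq> V" "P \<inter> Q = {}" "\<And>u v. u \<in> P \<Longrightarrow> v \<in> Q \<Longrightarrow> {u, v} \<notin> E"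
    and "ind_homology TYPE('k::field) E (P \<union> Q) n"
  shows "\<exists>i j. i + j = n \<and> ind_homology TYPE('k) E P i \<and> ind_homology TYPE('k) E Q j"
proof -
  have "finite P" "finite Q" using assms(1,2) finite_V finite_subset by blast+
  then show ?thesis
    using join_homology_nonzeroD[OF complex_on_Ind complex_on_Ind assms(3), where 'k = 'k]
      Ind_Un[OF assms(4)] assms(5)
    by simp
qed

text \<open>The complex consists of two isolated points. Their difference is a reduced cycle, and no
  face has two vertices to bound it. Degrees count vertices, so 1 means reduced homology in
  dimension 0.\<close>

lemma homology_edge:
  assumes e: "{x, y} \<in> E"
  shows "ind_homology TYPE('k::field) E {x, y} 1"
proof -
  have xy: "x \<noteq> y" using simple_graph_edgeD[OF simple e] by blast
  have Ind: "Ind E {x, y} = {{}, {x}, {y}}"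
  proof -
    have "Ind E {x, y} \<subseteq> Pow {x, y} - {{x, y}}" using e by (auto simp: Ind_def)
    moreover have "Pow {x, y} - {{x, y}} = {{}, {x}, {y}}" using xy by (auto simp: Pow_insert)
    moreover have "{} \<in> Ind E {x, y}" "{x} \<in> Ind E {x, y}" "{y} \<in> Ind E {x, y}"
      using simple_graph_no_loop[OF simple] by (simp_all add: Ind_def)
    ultimately show ?thesis by blast
  qed
  have cx: "complex_on {x, y} (Ind E {x, y})" by (rule complex_on_Ind) simp
  define c :: "'a set \<Rightarrow> 'k" where "c \<sigma> = (if \<sigma> = {x} then 1 else if \<sigma> = {y} then -1 else 0)" for \<sigma>
  have c_ch: "c \<in> chains (Ind E {x, y}) 1" by (auto simp: chains_def c_def Ind)
  have "bd {x, y} c \<tau> = 0" for \<tau>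
  proof (cases "\<tau> = {}")
    case True
    then show ?thesis using xy by (simp add: bd_def c_def bd_sign_def)
  next
    case False
    then have "v \<in> {x, y} - \<tau> \<Longrightarrow> c (insert v \<tau>) = 0" for v
      using xy by (auto simp: c_def)
    then show ?thesis by (simp add: bd_def)
  qed
  moreover have "c \<noteq> bd {x, y} b" if "b \<in> chains (Ind E {x, y}) (Suc 1)" for b
  proof -
    have "b \<sigma> = 0" for \<sigma>
      using chainsD(1,2)[OF that, of \<sigma>] unfolding Ind by fastforce
    then have "bd {x, y} b {x} = 0" by (simp add: bd_def)
    moreover have "c {x} = 1" by (simp add: c_def)
    ultimately show ?thesis by auto
  qed
  ultimately show ?thesis
    unfolding red_homology_nonzero_iff[OF cx] using c_ch by blast
qed

text \<open>The empty face is a nonbounding cycle of the complex \<open>{{}}\<close>. This keeps the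
  set whose maximum defines \<open>reg\<close> from being empty.\<close>

lemma homology_empty: "ind_homology TYPE('k::field) E {} 0"
proof -
  have Ind: "Ind E {} = {{}}" by (auto simp: Ind_def)
  have cx: "complex_on {} (Ind E {})" by (rule complex_on_Ind) simp
  have "(\<lambda>\<sigma>. if \<sigma> = {} then 1 else 0 :: 'k) \<in> chains (Ind E {}) 0" by (auto simp: chains_def Ind)
  moreover have "(\<lambda>\<sigma>. if \<sigma> = {} then 1 else 0 :: 'k) \<noteq> bd {} b" for b
    by (auto simp: bd_def fun_eq_iff)
  moreover have "bd {} c = (\<lambda>_. 0)" for c :: "'a set \<Rightarrow> 'k" by (simp add: fun_eq_iff bd_def)
  ultimately show ?thesis unfolding red_homology_nonzero_iff[OF cx] by blast
qed

text \<open>A nonzero class needs a face with \<open>n\<close> vertices. The resulting bound makes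
  the maximum in \<open>reg\<close> meaningful.\<close>

lemma homology_le_card:
  assumes "ind_homology TYPE('k::field) E S n" "finite S"
  shows "n \<le> card S"
proof -
  note cx = complex_on_Ind[OF assms(2), of E]
  obtain c :: "'a set \<Rightarrow> 'k" where c: "c \<in> chains (Ind E S) n"
      "\<And>b. b \<in> chains (Ind E S) (Suc n) \<Longrightarrow> c \<noteq> bd S b"
    using assms(1) red_homology_nonzero_iff[OF cx] by blast
  have "(\<lambda>_. 0) \<in> chains (Ind E S) (Suc n)" by (simp add: chains_def)
  moreover have "bd S (\<lambda>_. 0) = (\<lambda>_. 0 :: 'k)" by (simp add: fun_eq_iff bd_def)
  ultimately obtain \<sigma> where "c \<sigma> \<noteq> 0" using c(2)[of "\<lambda>_. 0"] by (metis ext)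
  then have "\<sigma> \<subseteq> S" "card \<sigma> = n" using chainsD(1,2)[OF c(1)] complex_onD(2)[OF cx] by blast+
  then show ?thesis using card_mono assms(2) by blast
qed

section \<open>Top homology of a prime graph and bridges\<close>

text \<open>A proper subset misses some vertex \<open>x\<close>, so its homology is counted by the
  regularity after deletion of \<open>x\<close>, which is smaller. The maximum is thus attained on
  \<open>V\<close> alone.\<close>

lemma prime_graph_homology:
  assumes "prime_graph TYPE('k::field) V E"
  obtains r where "ind_homology TYPE('k) E V r"
    "\<And>S n. S \<subset> V \<Longrightarrow> ind_homology TYPE('k) E S n \<Longrightarrow> n < r"
proof -
  have bounded: "finite {j. \<exists>S \<subseteq> U. ind_homology TYPE('k) E S j}" if "U \<subseteq> V" for U
  proof (rule finite_subset)
    show "{j. \<exists>S \<subseteq> U. ind_homology TYPE('k) E S j} \<subseteq> {..card V}"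
    proof
      fix j assume "j \<in> {j. \<exists>S \<subseteq> U. ind_homology TYPE('k) E S j}"
      then obtain S where S: "S \<subseteq> V" "ind_homology TYPE('k) E S j" using \<open>U \<subseteq> V\<close> by blast
      then have "j \<le> card S" using homology_le_card finite_subset[OF _ finite_V] by blast
      also have "\<dots> \<le> card V" using S(1) finite_V by (rule card_mono[rotated])
      finally show "j \<in> {..card V}" by simp
    qed
  qed simp
  let ?r = "reg TYPE('k) V E"
  have small: "n < ?r" if "S \<subset> V" "ind_homology TYPE('k) E S n" for S n
  proof -
    obtain x where x: "x \<in> V" "x \<notin> S" using \<open>S \<subset> V\<close> by blast
    have "Ind (del_vertex_E E x) T = Ind E T" if "T \<subseteq> V - {x}" for T
      using that by (auto simp: Ind_def del_vertex_E_def)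
    then have "{j. \<exists>T \<subseteq> V - {x}. red_homology_nonzero TYPE('k) (Ind (del_vertex_E E x) T) j} =
        {j. \<exists>T \<subseteq> V - {x}. ind_homology TYPE('k) E T j}"
      by (metis (lifting))
    then have "reg TYPE('k) (del_vertex_V V x) (del_vertex_E E x) =
        Max {j. \<exists>T \<subseteq> V - {x}. ind_homology TYPE('k) E T j}"
      by (simp add: reg_def del_vertex_V_def)
    moreover have "n \<le> Max {j. \<exists>T \<subseteq> V - {x}. ind_homology TYPE('k) E T j}"
      by (rule Max_ge[OF bounded]) (use that x in auto)
    moreover have "reg TYPE('k) (del_vertex_V V x) (del_vertex_E E x) < ?r"
      using assms x unfolding prime_graph_def by blast
    ultimately show ?thesis by simp
  qed
  have "?r \<in> {j. \<exists>S \<subseteq> V. ind_homology TYPE('k) E S j}"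
    unfolding reg_def by (rule Max_in[OF bounded]) (use homology_empty in auto)
  then have "ind_homology TYPE('k) E V ?r" using small by (auto simp: psubset_eq)
  then show ?thesis using that small by blast
qed

text \<open>Deleting \<open>y\<close> kills the top homology, so it survives in the link of \<open>y\<close>; that link is a
  join because the only edge between the two sides ends in \<open>y\<close>.\<close>

lemma bridge_link_homology:
  assumes V: "V = A \<union> B" "A \<inter> B = {}" and xy: "x \<in> A" "y \<in> B" "{x, y} \<in> E"
    and bridge: "\<And>u v. u \<in> A \<Longrightarrow> v \<in> B \<Longrightarrow> {u, v} \<in> E \<Longrightarrow> u = x \<and> v = y"
    and h: "ind_homology TYPE('k::field) E V (Suc n)"
      "\<not> ind_homology TYPE('k) E (V - {y}) (Suc n)"
  shows "\<exists>i j. i + j = n \<and> ind_homology TYPE('k) E (A - {x}) i \<and>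
    ind_homology TYPE('k) E (B - {y} - {u. {u, y} \<in> E}) j"
proof -
  have eq: "V - {y} - {u. {u, y} \<in> E} = (A - {x}) \<union> (B - {y} - {u. {u, y} \<in> E})"
    using V xy bridge by blast
  have "ind_homology TYPE('k) E ((A - {x}) \<union> (B - {y} - {u. {u, y} \<in> E})) n"
    using homology_deletion[of V y n] h V(1) xy unfolding eq by blast
  then show ?thesis
    by (intro homology_disjoint_UnD) (use V bridge in blast)+
qed

text \<open>The two recombined sets carry degrees \<open>i + j'\<close> and
  \<open>1 + i' + j\<close>, with sum \<open>2 * r - 1\<close>, so both cannot be below
  \<open>r\<close>. The neighbour \<open>z\<close> of \<open>x\<close> makes the second set
  proper.\<close>

lemma bridge_not_critical:
  assumes V: "V = A \<union> B" "A \<inter> B = {}" and xy: "x \<in> A" "y \<in> B" "{x, y} \<in> E"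
    and bridge: "\<And>u v. u \<in> A \<Longrightarrow> v \<in> B \<Longrightarrow> {u, v} \<in> E \<Longrightarrow> u = x \<and> v = y"
    and z: "z \<in> A" "{z, x} \<in> E"
    and top: "ind_homology TYPE('k::field) E V r"
    and small: "\<And>S n. S \<subset> V \<Longrightarrow> ind_homology TYPE('k) E S n \<Longrightarrow> n < r"
  shows False
proof -
  have zx: "z \<noteq> x" "z \<noteq> y" using simple_graph_edgeD[OF simple z(2)] z(1) V xy by auto
  let ?A = "A - {x} - {u. {u, x} \<in> E}" and ?B = "B - {y} - {u. {u, y} \<in> E}"
  have "{x, y} \<subset> V" using V xy z zx by blast
  \<comment> \<open>The edge alone misses \<open>z\<close>, so its class lies below the top; hence
    \<open>r\<close> is a successor.\<close>
  then have "1 < r" using small homology_edge[OF xy(3)] by blast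
  then obtain n where n: "r = Suc n" by (cases r) auto
  have "\<not> ind_homology TYPE('k) E (V - {v}) (Suc n)" if "v \<in> V" for v
    using small[of "V - {v}" r] that n by blast
  then have nx: "\<not> ind_homology TYPE('k) E (V - {x}) (Suc n)"
    and ny: "\<not> ind_homology TYPE('k) E (V - {y}) (Suc n)"
    using V xy by auto
  obtain i j where ij: "i + j = n" "ind_homology TYPE('k) E (A - {x}) i" "ind_homology TYPE('k) E ?B j"
    using bridge_link_homology[OF V xy bridge top[unfolded n] ny] by blast
  \<comment> \<open>The same argument with the two sides of the bridge exchanged.\<close>
  have "V = B \<union> A" "B \<inter> A = {}" "{y, x} \<in> E" using V xy(3) by (auto simp: insert_commute)
  moreover have "u = y \<and> v = x" if "u \<in> B" "v \<in> A" "{u, v} \<in> E" for u v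
    using bridge[of v u] that by (simp add: insert_commute)
  ultimately obtain j' i' where ji: "j' + i' = n" "ind_homology TYPE('k) E (B - {y}) j'"
      "ind_homology TYPE('k) E ?A i'"
    using bridge_link_homology[of B A y x n] xy(1,2) top[unfolded n] nx by blast
  have "ind_homology TYPE('k) E ((A - {x}) \<union> (B - {y})) (i + j')"
    by (rule homology_disjoint_UnI[OF _ _ _ _ ij(2) ji(2)]) (use V bridge in blast)+
  then have "i + j' < r" by (rule small[rotated]) (use V xy in blast)
  have "ind_homology TYPE('k) E (?A \<union> ?B) (i' + j)"
    by (rule homology_disjoint_UnI[OF _ _ _ _ ji(3) ij(3)]) (use V bridge in blast)+
  then have "ind_homology TYPE('k) E ({x, y} \<union> (?A \<union> ?B)) (1 + (i' + j))"
  proof (rule homology_disjoint_UnI[OF _ _ _ _ homology_edge[OF xy(3)], rotated 4])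
    show "{x, y} \<subseteq> V" "?A \<union> ?B \<subseteq> V" "{x, y} \<inter> (?A \<union> ?B) = {}" using V xy by auto
    \<comment> \<open>Neighbours of \<open>x\<close> in \<open>A\<close> and of \<open>y\<close> in
      \<open>B\<close> have been removed, and the only edge across is \<open>{x, y}\<close>.\<close>
    show "{u, v} \<notin> E" if "u \<in> {x, y}" "v \<in> ?A \<union> ?B" for u v
      using that bridge[of x v] bridge[of v y] xy by (auto simp: insert_commute)
  qed
  then have "1 + (i' + j) < r"
  proof (rule small[rotated])
    have "z \<notin> {x, y} \<union> (?A \<union> ?B)" using z zx V by auto
    then show "{x, y} \<union> (?A \<union> ?B) \<subset> V" using V xy z by blast
  qed
  then show False using \<open>i + j' < r\<close> ij(1) ji(1) n by linarith
qed

end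

section \<open>Cut vertices\<close>

text \<open>A walk from \<open>a\<close> to \<open>b\<close> has to leave \<open>S\<close> along
  some edge.\<close>

lemma connected_graph_cut_edge:
  assumes "connected_graph V E" "a \<in> S" "a \<in> V" "b \<in> V" "b \<notin> S"
  obtains s t where "s \<in> S" "t \<notin> S" "{s, t} \<in> E"
proof -
  have "(\<lambda>a b. {a, b} \<in> E)\<^sup>*\<^sup>* a b" using assms unfolding connected_graph_def by blast
  then have "b \<notin> S \<longrightarrow> (\<exists>s t. s \<in> S \<and> t \<notin> S \<and> {s, t} \<in> E)"
    by (induction rule: rtranclp_induct) (use assms(2) in blast)+
  then show ?thesis using assms(5) that by blast
qed

text \<open>Were \<open>y\<close> the only neighbour of \<open>w\<close> in \<open>P\<close>, the
  edge \<open>{w, y}\<close> would be a bridge between \<open>insert w Q\<close> and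
  \<open>P\<close>. A neighbour \<open>z\<close> of \<open>w\<close> in \<open>Q\<close> then
  contradicts \<open>bridge_not_critical\<close>.\<close>

lemma cut_vertex_has_two_neighbours:
  fixes V :: "'a::linorder set"
  assumes simple: "simple_graph V E" and prime: "prime_graph TYPE('k::field) V E"
    and V: "V - {w} = P \<union> Q" "P \<inter> Q = {}" "w \<in> V" and ne: "P \<noteq> {}" "Q \<noteq> {}"
    and sep: "\<And>u v. u \<in> P \<Longrightarrow> v \<in> Q \<Longrightarrow> {u, v} \<notin> E"
  shows "card {u \<in> P. {u, w} \<in> E} \<ge> 2"
proof -
  have conn: "connected_graph V E" using prime by (simp add: prime_graph_def)
  \<comment> \<open>An edge leaving \<open>R\<close> exists by connectedness and can end only in
    \<open>w\<close>.\<close>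
  have nbr: "\<exists>s\<in>R. {s, w} \<in> E"
    if R: "R \<noteq> {}" "R \<subseteq> V - {w}" "\<And>u v. u \<in> R \<Longrightarrow> v \<in> V - {w} - R \<Longrightarrow> {u, v} \<notin> E" for R
  proof -
    obtain a where "a \<in> R" using \<open>R \<noteq> {}\<close> by blast
    then obtain s t where st: "s \<in> R" "t \<notin> R" "{s, t} \<in> E"
      using connected_graph_cut_edge[OF conn, of a R w] R(2) V(3) by blast
    then have "t = w" using R(3) simple_graph_edgeD[OF simple st(3)] by blast
    then show ?thesis using st by blast
  qed
  have "finite P" using V(1) simple unfolding simple_graph_def by (metis finite_Diff finite_Un)
  then have fin: "finite {u \<in> P. {u, w} \<in> E}" by simp
  obtain y where y: "y \<in> P" "{y, w} \<in> E" using nbr[of P] V sep ne by blast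
  obtain z where z: "z \<in> Q" "{z, w} \<in> E"
    using nbr[of Q] V sep ne by (metis Diff_iff Un_iff Un_upper2 insert_commute)
  show ?thesis
  proof (rule ccontr)
    assume "\<not> ?thesis"
    then have uniq: "u = y" if "u \<in> P" "{u, w} \<in> E" for u
      using y that card_le_Suc0_iff_eq[OF fin] by simp
    obtain r where r: "red_homology_nonzero TYPE('k) (Ind E V) r"
      "\<And>S n. S \<subset> V \<Longrightarrow> red_homology_nonzero TYPE('k) (Ind E S) n \<Longrightarrow> n < r"
      using prime_graph_homology[OF simple prime] by blast
    show False
    proof (rule bridge_not_critical[OF simple _ _ _ _ _ _ _ _ r])
      show "V = insert w Q \<union> P" "insert w Q \<inter> P = {}" "w \<in> insert w Q" "y \<in> P" "{w, y} \<in> E"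
        "z \<in> insert w Q" "{z, w} \<in> E"
        using V y z by (auto simp: insert_commute)
      show "u = w \<and> v = y" if "u \<in> insert w Q" "v \<in> P" "{u, v} \<in> E" for u v
        using that sep[of v u] uniq[of v] by (auto simp: insert_commute)
    qed
  qed
qed

text \<open>A cut vertex would have two neighbours on each side of a separation, hence degree at
  least 4.\<close>

theorem mainTheorem8:
  fixes V :: "'a::linorder set" and E :: "'a set set"
  assumes "simple_graph V E"
    and "bipartite V E"
    and "max_degree_le V E 3"
    and "card V \<ge> 3"
    and "prime_graph TYPE('k::field) V E"
  shows "two_connected V E"
  unfolding two_connected_def
proof (intro conjI ballI)
  show "3 \<le> card V" "connected_graph V E" using assms(4,5) by (auto simp: prime_graph_def)
  fix w assume w: "w \<in> V"
  show "connected_graph (del_vertex_V V w) (del_vertex_E E w)"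
  proof (rule ccontr)
    assume disc: "\<not> ?thesis"
    have fin: "finite V" using assms(1) by (simp add: simple_graph_def)
    \<comment> \<open>The empty graph counts as disconnected; excluding it leaves two vertices with
      no path between them.\<close>
    have "card (V - {w}) \<noteq> 0" using assms(4) w fin by simp
    then have "V - {w} \<noteq> {}" by force
    let ?R = "\<lambda>a b. {a, b} \<in> del_vertex_E E w"
    obtain u v where uv: "u \<in> V - {w}" "v \<in> V - {w}" "\<not> ?R\<^sup>*\<^sup>* u v"
      using disc \<open>V - {w} \<noteq> {}\<close> unfolding connected_graph_def del_vertex_V_def by blast
    \<comment> \<open>\<open>P\<close> is the component of \<open>u\<close> after deletion of
      \<open>w\<close>, and \<open>Q\<close> is the rest, which contains \<open>v\<close>.\<close>
    define P Q where "P = {z \<in> V - {w}. ?R\<^sup>*\<^sup>* u z}" and "Q = V - {w} - P"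
    have V: "V - {w} = P \<union> Q" "P \<inter> Q = {}" and ne: "P \<noteq> {}" "Q \<noteq> {}"
      using uv by (auto simp: P_def Q_def)
    have sep: "{a, b} \<notin> E" if "a \<in> P" "b \<in> Q" for a b
    proof
      assume "{a, b} \<in> E"
      then have "?R a b" using that by (auto simp: P_def Q_def del_vertex_E_def)
      then have "?R\<^sup>*\<^sup>* u b" using that by (auto simp: P_def intro: rtranclp.rtrancl_into_rtrancl)
      then show False using that by (auto simp: P_def Q_def)
    qed
    have "2 \<le> card {a \<in> P. {a, w} \<in> E}"
      by (rule cut_vertex_has_two_neighbours[OF assms(1,5) V w ne sep])
    moreover have "V - {w} = Q \<union> P" "Q \<inter> P = {}" using V by auto
    then have "2 \<le> card {a \<in> Q. {a, w} \<in> E}"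
      by (rule cut_vertex_has_two_neighbours[OF assms(1,5) _ _ w ne(2,1)])
        (metis sep insert_commute)
    moreover have "card {a. {a, w} \<in> E} = card {a \<in> P. {a, w} \<in> E} + card {a \<in> Q. {a, w} \<in> E}"
    proof -
      have "{a. {a, w} \<in> E} = {a \<in> P. {a, w} \<in> E} \<union> {a \<in> Q. {a, w} \<in> E}"
      proof (intro set_eqI iffI)
        fix a assume "a \<in> {a. {a, w} \<in> E}"
        moreover from this have "a \<in> V - {w}" using simple_graph_edgeD[OF assms(1), of a w] by simp
        ultimately show "a \<in> {a \<in> P. {a, w} \<in> E} \<union> {a \<in> Q. {a, w} \<in> E}" using V(1) by simp
      qed auto
      moreover have "finite P" "finite Q" using fin by (simp_all add: P_def Q_def)
      then have "card ({a \<in> P. {a, w} \<in> E} \<union> {a \<in> Q. {a, w} \<in> E}) =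
          card {a \<in> P. {a, w} \<in> E} + card {a \<in> Q. {a, w} \<in> E}"
        by (intro card_Un_disjoint) (use V(2) in auto)
      ultimately show ?thesis by (simp only:)
    qed
    moreover have "card {a. {a, w} \<in> E} \<le> 3"
      using assms(3) w by (simp add: max_degree_le_def degree_def)
    ultimately show False by linarith
  qed
qed

end
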